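(* Let $\omega$ be a (II)-admissible weight and let $\varphi:\mathbb D\to\mathbb D$ be analytic with $\varphi\in\mathcal H_\omega$. Then (i) $C_\varphi$ is bounded on $\mathcal H_\omega$ if and only if $$\sup_{0<\delta<1}\ \sup_{\zeta\in\mathbb T}\ \frac{1}{\delta^2\,\omega(1-\delta)}\int_{\{z\in\mathbb D:\,|z-\zeta|<\delta\}}N_{\varphi,\omega}(z)\,dA(z)<\infty;$$ (ii) $C_\varphi$ is compact on $\mathcal H_\omega$ if and only if $$\lim_{\delta\to0^+}\ \sup_{\zeta\in\mathbb T}\ \frac{1}{\delta^2\,\omega(1-\delta)}\int_{\{z\in\mathbb D:\,|z-\zeta|<\delta\}}N_{\varphi,\omega}(z)\,dA(z)=0.$$
   Context: $\mathbb D$ is the open unit disc, $\mathbb T$ the unit circle, $dA=dx\,dy/\pi$, $C_\varphi f=f\circ\varphi$. A weight function is a positive integrable $\omega\in C^2[0,1)$, extended by $\omega(z)=\omega(|z|)$. $\mathcal H_\omega$ is the space of analytic $f$ on $\mathbb D$ with $\|f\|^2=|f(0)|^2+\int_{\mathbb D}|f'(z)|^2\omega(z)\,dA(z)<\infty$. $\omega$ is (II)-admissible if: (W1) $\omega$ non-increasing; (W2) there is $\delta_0>0$ with $r\mapsto\omega(r)(1-r)^{-(1+\delta_0)}$ non-decreasing on $[0,1)$; (W3) $\lim_{r\to1^-}\omega(r)=0$; (W4(II)) $\omega$ concave. $N_{\varphi,\omega}(z)=\sum_{a\in\mathbb D,\ \varphi(a)=z}\omega(a)$ (with multiplicity) for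 $z\ne\varphi(0)$, and $N_{\varphi,\omega}(\varphi(0))=0$. *)

theory Defs
  imports "HOL-Analysis.Analysis"
begin

text \<open>Weight functions: omega is a real function on [0,1); the radial extension
  omega(z) = omega(|z|) is written explicitly as omega (cmod z).\<close>

definition weight_function :: "(real \<Rightarrow> real) \<Rightarrow> bool" where
  "weight_function \<omega> \<longleftrightarrow>
     (\<forall>r\<in>{0..<1}. \<omega> r > 0) \<and>
     set_integrable lborel {0..<1::real} \<omega> \<and>
     (\<exists>\<omega>1 \<omega>2. (\<forall>r\<in>{0..<1}. (\<omega> has_real_derivative \<omega>1 r) (at r within {0..<1})) \<and>
              (\<forall>r\<in>{0..<1}. (\<omega>1 has_real_derivative \<omega>2 r) (at r within {0..<1})) \<and>
              continuous_on {0..<1} \<omega>2)"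

definition admissible_II :: "(real \<Rightarrow> real) \<Rightarrow> bool" where
  "admissible_II \<omega> \<longleftrightarrow>
     weight_function \<omega> \<and>
     \<comment> \<open>(W1) non-increasing\<close>
     (\<forall>x y. 0 \<le> x \<and> x \<le> y \<and> y < 1 \<longrightarrow> \<omega> y \<le> \<omega> x) \<and>
     \<comment> \<open>(W2)\<close>
     (\<exists>\<delta>0>0. \<forall>x y. 0 \<le> x \<and> x \<le> y \<and> y < 1 \<longrightarrow>
        \<omega> x * (1 - x) powr (-(1 + \<delta>0)) \<le> \<omega> y * (1 - y) powr (-(1 + \<delta>0))) \<and>
     \<comment> \<open>(W3)\<close>
     (\<omega> \<longlongrightarrow> 0) (at_left 1) \<and>
     \<comment> \<open>(W4(II)) concave\<close>
     concave_on {0..<1} \<omega>"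

text \<open>Dirichlet-type integral  int_D |f'(z)|^2 omega(z) dA(z), with dA = dx dy / pi.\<close>
definition Dint :: "(real \<Rightarrow> real) \<Rightarrow> (complex \<Rightarrow> complex) \<Rightarrow> ennreal" where
  "Dint \<omega> f = (\<integral>\<^sup>+ z \<in> ball 0 1. ennreal ((cmod (deriv f z))\<^sup>2 * \<omega> (cmod z)) \<partial>lborel) / ennreal pi"

definition Hw :: "(real \<Rightarrow> real) \<Rightarrow> (complex \<Rightarrow> complex) set" where
  "Hw \<omega> = {f. f holomorphic_on ball 0 1 \<and> Dint \<omega> f < \<infinity>}"

definition Hnorm :: "(real \<Rightarrow> real) \<Rightarrow> (complex \<Rightarrow> complex) \<Rightarrow> real" where
  "Hnorm \<omega> f = sqrt ((cmod (f 0))\<^sup>2 + enn2real (Dint \<omega> f))"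

definition comp_bounded :: "(real \<Rightarrow> real) \<Rightarrow> (complex \<Rightarrow> complex) \<Rightarrow> bool" where
  "comp_bounded \<omega> \<phi> \<longleftrightarrow>
     (\<forall>f\<in>Hw \<omega>. f \<circ> \<phi> \<in> Hw \<omega>) \<and>
     (\<exists>C. \<forall>f\<in>Hw \<omega>. Hnorm \<omega> (f \<circ> \<phi>) \<le> C * Hnorm \<omega> f)"

definition comp_compact :: "(real \<Rightarrow> real) \<Rightarrow> (complex \<Rightarrow> complex) \<Rightarrow> bool" where
  "comp_compact \<omega> \<phi> \<longleftrightarrow>
     (\<forall>f\<in>Hw \<omega>. f \<circ> \<phi> \<in> Hw \<omega>) \<and>
     (\<forall>F :: nat \<Rightarrow> complex \<Rightarrow> complex. (\<forall>n. F n \<in> Hw \<omega>) \<and> (\<exists>B. \<forall>n. Hnorm \<omega> (F n) \<le> B) \<longrightarrow>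
        (\<exists>r g. strict_mono r \<and> g \<in> Hw \<omega> \<and>
           (\<lambda>n. Hnorm \<omega> (\<lambda>z. (F (r n) \<circ> \<phi>) z - g z)) \<longlonglongrightarrow> 0))"

text \<open>Multiplicity of a as a zero of phi - phi(a) (phi holomorphic, non-constant):
  the order of the first non-vanishing derivative.\<close>
definition zero_mult :: "(complex \<Rightarrow> complex) \<Rightarrow> complex \<Rightarrow> nat" where
  "zero_mult \<phi> a = (LEAST n. n \<ge> 1 \<and> (deriv ^^ n) \<phi> a \<noteq> 0)"

definition Ncount :: "(real \<Rightarrow> real) \<Rightarrow> (complex \<Rightarrow> complex) \<Rightarrow> complex \<Rightarrow> ennreal" where
  "Ncount \<omega> \<phi> z =
     (if z = \<phi> 0 then 0
      else \<integral>\<^sup>+ a. indicator {a \<in> ball 0 1. \<phi> a = z} a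
                  * ennreal (real (zero_mult \<phi> a) * \<omega> (cmod a)) \<partial>count_space UNIV)"

definition carleson_quot :: "(real \<Rightarrow> real) \<Rightarrow> (complex \<Rightarrow> complex) \<Rightarrow> real \<Rightarrow> complex \<Rightarrow> ennreal" where
  "carleson_quot \<omega> \<phi> \<delta> \<zeta> =
     ((\<integral>\<^sup>+ z \<in> {z \<in> ball 0 1. cmod (z - \<zeta>) < \<delta>}. Ncount \<omega> \<phi> z \<partial>lborel) / ennreal pi)
     / ennreal (\<delta>\<^sup>2 * \<omega> (1 - \<delta>))"

end

theory Submission
  imports Defs "HOL-Complex_Analysis.Complex_Analysis"
begin

text \<open>
  The area formula turns the Dirichlet integral of \<open>f \<circ> \<phi>\<close> into the integral of \<open>|f'|\<^sup>2\<close> against the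
  measure with density the counting function, so both parts become statements about Carleson
  embeddings of weighted Bergman spaces. Monotonicity and (W2) make the weight roughly constant on discs of radius
  comparable to the distance to the circle. Hence the sub-mean value property of \<open>|f'|\<^sup>2\<close> and Tonelli
  give sufficiency (with Montel's theorem for compactness), while necessity is tested on primitives
  of high negative powers of \<open>1 - cnj a * z\<close>.
\<close>

text \<open>The counting function is defined pointwise, with multiplicities and a special value at
  \<open>\<phi> 0\<close>, and is not visibly measurable. Only its integrals matter: for nonconstant
  \<open>\<phi>\<close> the critical values are countable, so almost everywhere it equals a Borel
  sum over noncritical preimages.

  (W2) is a power law for the weight; its exponent is rounded up to \<open>2 * q\<close>. It is even
  because holomorphic kernels enter squared: the derivative of a test function carries the power
  \<open>-(q + 2)\<close> of \<open>1 - cnj a * z\<close>, hence \<open>2 * q + 4\<close> powers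
  after squaring, of which \<open>2 * q\<close> compensate the variation of the weight and 4 leave
  an integral of order \<open>1 / \<delta>^2\<close>. Normalised this way, the squared derivative is
  at least of order \<open>1 / (\<delta>^2 * \<omega> (1 - \<delta>))\<close> on the part of the
  unit disc within \<delta> of the boundary point, which explains the denominator of the Carleson
  quotient.

  Small discs centred on the circle miss compact parts of the unit disc. There the embedding uses
  that the whole measure is finite, which is the hypothesis that the symbol lies in the
  space.\<close>

section \<open>Transport to \<open>real^2\<close> and change of variables for injective holomorphic
  maps\<close>

definition complex_of_vec2 :: "real^2 \<Rightarrow> complex" where
  "complex_of_vec2 x = Complex (vec_nth x 1) (vec_nth x 2)"

definition vec2_of_complex :: "complex \<Rightarrow> real^2" where
  "vec2_of_complex z = vector [Re z, Im z]"

lemma complex_of_vec2_inverse [simp]: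
  "complex_of_vec2 (vec2_of_complex z) = z" "vec2_of_complex (complex_of_vec2 x) = x"
  by (simp_all add: complex_of_vec2_def vec2_of_complex_def vec_eq_iff forall_2)

lemma linear_complex_of_vec2: "linear complex_of_vec2"
  by (rule linearI) (auto simp: complex_of_vec2_def complex_eq_iff)

lemma linear_vec2_of_complex: "linear vec2_of_complex"
  by (rule linearI) (auto simp: vec2_of_complex_def vec_eq_iff forall_2)

lemma vimage_complex_of_vec2: "complex_of_vec2 -` A = vec2_of_complex ` A"
  by (force simp: image_iff)

lemma complex_of_vec2_borel_measurable [measurable]: "complex_of_vec2 \<in> borel \<rightarrow>\<^sub>M borel"
  by (intro borel_measurable_continuous_onI linear_continuous_on
      linear_conv_bounded_linear[THEN iffD1] linear_complex_of_vec2)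

text \<open>Lebesgue measure is determined by its values on boxes, and the coordinate map pulls
  boxes back to boxes with the same side lengths. This carries change of variables, stated with
  determinants on \<open>real^2\<close>, over to the complex plane.\<close>

lemma lborel_complex_eq_distr: "(lborel :: complex measure) = distr lborel borel complex_of_vec2"
proof (rule lborel_eqI)
  fix l u :: complex
  assume le: "\<And>b. b \<in> Basis \<Longrightarrow> l \<bullet> b \<le> u \<bullet> b"
  have "complex_of_vec2 -` box l u = box (vec2_of_complex l) (vec2_of_complex u)"
    by (auto simp: box_def complex_of_vec2_def vec2_of_complex_def Basis_complex_def
        Basis_vec_def inner_axis forall_2)
  moreover have "emeasure lborel (box (vec2_of_complex l) (vec2_of_complex u)) = (\<Prod>b\<in>Basis. (u - l) \<bullet> b)"
  proof -
    have B: "(Basis :: (real^2) set) = {axis 1 1, axis 2 1}"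
      by (auto simp: Basis_vec_def UNIV_2)
    have "axis 1 1 \<noteq> (axis 2 1 :: real^2)"
      by (simp add: axis_eq_axis)
    then show ?thesis
      using le[of 1] le[of \<i>]
      by (subst emeasure_lborel_box)
         (auto simp: B inner_axis vec2_of_complex_def Basis_complex_def)
  qed
  ultimately show "emeasure (distr lborel borel complex_of_vec2) (box l u) = (\<Prod>b\<in>Basis. (u - l) \<bullet> b)"
    by (simp add: emeasure_distr)
qed auto

lemma nn_integral_lborel_complex:
  assumes [measurable]: "f \<in> borel_measurable borel"
  shows "(\<integral>\<^sup>+z. f z \<partial>lborel) = (\<integral>\<^sup>+x. f (complex_of_vec2 x) \<partial>lborel)"
  by (subst lborel_complex_eq_distr, subst nn_integral_distr) auto

lemma emeasure_lborel_complex: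
  assumes [measurable]: "A \<in> sets borel"
  shows "emeasure lborel A = emeasure lborel (complex_of_vec2 -` A)"
  by (subst lborel_complex_eq_distr, subst emeasure_distr) auto

text \<open>Multiplication by \<open>c\<close> is a rotation followed by a dilation by |c|; this is
  the real Jacobian of a holomorphic map with derivative \<open>c\<close>.\<close>

lemma det_matrix_complex_mult:
  "det (matrix (\<lambda>x. vec2_of_complex (c * complex_of_vec2 x))) = (cmod c)\<^sup>2"
  by (simp add: det_2 matrix_def vec2_of_complex_def complex_of_vec2_def axis_def
      cmod_def power2_eq_square[symmetric])

lemma borel_measurable_indicator_mult:
  fixes f :: "'a::topological_space \<Rightarrow> real"
  assumes "A \<in> sets borel" "continuous_on A f"
  shows "(\<lambda>x. indicator A x * f x) \<in> borel_measurable borel"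
  using borel_measurable_continuous_on_indicator[OF assms] by simp

text \<open>A continuous image of a Borel set need not be Borel. Here the inverse is holomorphic on
  the open image of \<open>S\<close>, so the image of \<open>E\<close> is the preimage of
  \<open>E\<close> under a continuous map.\<close>

lemma borel_image_holomorphic:
  assumes "open S" "\<phi> holomorphic_on S" "inj_on \<phi> S" "E \<in> sets borel" "E \<subseteq> S"
  shows "\<phi> ` E \<in> sets borel"
proof -
  obtain g where g: "g holomorphic_on (\<phi> ` S)" "\<And>z. z \<in> S \<Longrightarrow> g (\<phi> z) = z"
    using holomorphic_has_inverse[OF assms(2,1,3)] by metis
  have op: "open (\<phi> ` S)"
    using open_mapping_thm3 assms by blast
  have "g -` E \<inter> (\<phi> ` S) \<in> sets borel"
    using measurable_sets[OF borel_measurable_continuous_on_restrict[OF holomorphic_on_imp_continuous_on[OF g(1)]] assms(4)] op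
    by (simp add: space_restrict_space sets_restrict_space_iff)
  also have "g -` E \<inter> (\<phi> ` S) = \<phi> ` E"
    using g assms(5) by auto
  finally show ?thesis .
qed

text \<open>In real coordinates the derivative is multiplication by \<open>deriv \<phi> z\<close>,
  whose determinant is its squared modulus, so the real change of variables theorem applies.
  Boundedness of the image makes its measure finite, as a real-valued integral demands.\<close>

lemma emeasure_holomorphic_image:
  assumes S: "open S" "\<phi> holomorphic_on S" "inj_on \<phi> S"
    and E: "E \<in> sets borel" "E \<subseteq> S" "bounded (\<phi> ` E)"
  shows "emeasure lborel (\<phi> ` E) = (\<integral>\<^sup>+z\<in>E. ennreal ((cmod (deriv \<phi> z))\<^sup>2) \<partial>lborel)"
proof -
  let ?C = complex_of_vec2 and ?V = vec2_of_complex
  have [measurable]: "\<phi> ` E \<in> sets borel"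
    using borel_image_holomorphic assms by blast
  define g where "g = ?V \<circ> \<phi> \<circ> ?C"
  have gi: "g ` (?V ` E) = ?V ` (\<phi> ` E)"
    by (force simp: g_def)
  have VE: "?V ` E \<in> sets borel"
    using measurable_sets[OF complex_of_vec2_borel_measurable E(1)]
    by (simp add: vimage_complex_of_vec2)
  have der: "(g has_derivative (\<lambda>x. ?V (deriv \<phi> (?C x0) * ?C x))) (at x0 within ?V ` E)"
    if "x0 \<in> ?V ` E" for x0
  proof -
    have "?C x0 \<in> S" using that E by auto
    then have "(\<phi> has_derivative (*) (deriv \<phi> (?C x0))) (at (?C x0))"
      using S holomorphic_derivI has_field_derivative_def by blast
    moreover have "(?C has_derivative ?C) (at x0)" "(?V has_derivative ?V) (at y)" for y
      by (intro linear_imp_has_derivative linear_complex_of_vec2 linear_vec2_of_complex)+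
    ultimately have "(g has_derivative ?V \<circ> (*) (deriv \<phi> (?C x0)) \<circ> ?C) (at x0)"
      unfolding g_def using diff_chain_at by (metis comp_assoc comp_apply)
    then show ?thesis
      by (auto simp: o_def intro: has_derivative_at_withinI)
  qed
  have inj: "inj_on g (?V ` E)"
    using S(3) E(2) by (auto simp: inj_on_def g_def) (metis complex_of_vec2_inverse(1) subsetD)+
  have lm: "g ` (?V ` E) \<in> lmeasurable"
  proof -
    have "?V ` \<phi> ` E \<in> sets borel"
      using measurable_sets[OF complex_of_vec2_borel_measurable, of "\<phi> ` E"]
      by (simp add: vimage_complex_of_vec2)
    moreover have "bounded (?V ` \<phi> ` E)"
      by (intro bounded_linear_image E linear_conv_bounded_linear[THEN iffD1] linear_vec2_of_complex)
    ultimately show ?thesis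
      by (simp add: gi bounded_set_imp_lmeasurable)
  qed
  let ?J = "\<lambda>x. (cmod (deriv \<phi> (?C x)))\<^sup>2"
  have "(?J has_integral measure lebesgue (g ` (?V ` E))) (?V ` E)"
    using has_measure_differentiable_image[OF _ der inj] VE lm
    by (auto simp: det_matrix_complex_mult)
  moreover have cont: "continuous_on S (deriv \<phi>)"
    using S holomorphic_deriv holomorphic_on_imp_continuous_on by blast
  have Jm[measurable]: "(\<lambda>z. indicat_real E z * (cmod (deriv \<phi> z))\<^sup>2) \<in> borel_measurable borel"
  proof -
    have "continuous_on E (\<lambda>z. (cmod (deriv \<phi> z))\<^sup>2)"
      by (intro continuous_intros continuous_on_subset[OF cont E(2)])
    then show ?thesis
      by (rule borel_measurable_indicator_mult[OF E(1)])
  qed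
  ultimately have "((\<lambda>x. indicator E (?C x) * ?J x) has_integral measure lebesgue (g ` (?V ` E))) UNIV"
    apply (subst (asm) has_integral_restrict_UNIV[symmetric])
    apply (erule has_integral_eq[rotated])
    by (auto simp: indicator_def vimage_complex_of_vec2[symmetric])
  moreover have "(\<lambda>x. indicator E (?C x) * ?J x) \<in> borel_measurable borel"
    using measurable_compose[OF complex_of_vec2_borel_measurable Jm] by simp
  ultimately have "(\<integral>\<^sup>+x. ennreal (indicator E (?C x) * ?J x) \<partial>lborel) = ennreal (measure lebesgue (g ` (?V ` E)))"
    by (intro nn_integral_has_integral_lborel) auto
  also have "\<dots> = emeasure lebesgue (?V ` \<phi> ` E)"
    using lm by (simp add: gi emeasure_eq_measure2)
  also have "\<dots> = emeasure lborel (\<phi> ` E)"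
    by (subst emeasure_lborel_complex)
     (use measurable_sets[OF complex_of_vec2_borel_measurable, of "\<phi> ` E"] in \<open>auto simp: vimage_complex_of_vec2\<close>)
  also have "(\<integral>\<^sup>+x. ennreal (indicator E (?C x) * ?J x) \<partial>lborel) =
     (\<integral>\<^sup>+z. ennreal (indicator E z * (cmod (deriv \<phi> z))\<^sup>2) \<partial>lborel)"
    by (subst nn_integral_lborel_complex) auto
  finally show ?thesis
    unfolding nn_integral_set_ennreal by (simp add: mult.commute)
qed

text \<open>The volume formula, applied to the part of \<open>E\<close> that is mapped into an
  arbitrary Borel set, shows that the push-forward of the squared derivative on \<open>E\<close> is
  Lebesgue measure on the image. Integrating \<open>h\<close> against this one measure gives both
  sides.\<close>

lemma nn_integral_holomorphic_image:
  assumes S: "open S" "\<phi> holomorphic_on S" "inj_on \<phi> S"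
    and E: "E \<in> sets borel" "E \<subseteq> S" "bounded (\<phi> ` E)"
    and h[measurable]: "h \<in> borel_measurable borel"
  shows "(\<integral>\<^sup>+z\<in>E. h (\<phi> z) * ennreal ((cmod (deriv \<phi> z))\<^sup>2) \<partial>lborel) = (\<integral>\<^sup>+w\<in>\<phi> ` E. h w \<partial>lborel)"
proof -
  have [measurable]: "\<phi> ` E \<in> sets borel" "E \<in> sets borel"
    using borel_image_holomorphic assms by blast+
  \<comment> \<open>\<open>f\<close> extends \<phi> to a Borel map of the whole plane; the value 0
    off \<open>E\<close> is harmless because the density \<open>J\<close> vanishes there.\<close>
  define f where "f z = (if z \<in> E then \<phi> z else 0)" for z
  have [measurable]: "f \<in> borel_measurable borel"
    unfolding f_def
    by (intro borel_measurable_continuous_on_if E continuous_on_const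
        continuous_on_subset[OF holomorphic_on_imp_continuous_on[OF S(2)]])
  define J where "J z = ennreal (indicator E z * (cmod (deriv \<phi> z))\<^sup>2)" for z
  have [measurable]: "J \<in> borel_measurable borel"
  proof -
    have "continuous_on S (deriv \<phi>)"
      using S holomorphic_deriv holomorphic_on_imp_continuous_on by blast
    then have "continuous_on E (\<lambda>z. (cmod (deriv \<phi> z))\<^sup>2)"
      by (intro continuous_intros continuous_on_subset[OF _ E(2)])
    then show ?thesis
      unfolding J_def by (intro measurable_compose[OF _ measurable_ennreal] borel_measurable_indicator_mult[OF E(1)])
  qed
  have eq: "distr (density lborel J) borel f = density lborel (indicator (\<phi> ` E))"
  proof (rule measure_eqI)
    fix A assume "A \<in> sets (distr (density lborel J) borel f)"
    then have [measurable]: "A \<in> sets borel" by simp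
    have E': "E \<inter> f -` A \<in> sets borel"
      using measurable_sets[of f borel borel A] by (intro sets.Int) auto
    have im: "\<phi> ` (E \<inter> f -` A) = \<phi> ` E \<inter> A"
      by (auto simp: f_def)
    have "emeasure (distr (density lborel J) borel f) A = (\<integral>\<^sup>+z. J z * indicator (f -` A) z \<partial>lborel)"
      using measurable_sets[of f borel borel A] by (simp add: emeasure_distr emeasure_density)
    also have "\<dots> = (\<integral>\<^sup>+z\<in>E \<inter> f -` A. ennreal ((cmod (deriv \<phi> z))\<^sup>2) \<partial>lborel)"
      by (intro nn_integral_cong) (auto simp: J_def indicator_def)
    also have "\<dots> = emeasure lborel (\<phi> ` E \<inter> A)"
      using emeasure_holomorphic_image[OF S E'] E im by (metis bounded_subset inf.cobounded1 inf.coboundedI1)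
    also have "\<dots> = emeasure (density lborel (indicator (\<phi> ` E))) A"
      by (simp add: emeasure_density flip: indicator_inter_arith)
    finally show "emeasure (distr (density lborel J) borel f) A = emeasure (density lborel (indicator (\<phi> ` E))) A" .
  qed simp
  have "(\<integral>\<^sup>+z\<in>E. h (\<phi> z) * ennreal ((cmod (deriv \<phi> z))\<^sup>2) \<partial>lborel) = (\<integral>\<^sup>+z. J z * h (f z) \<partial>lborel)"
    by (intro nn_integral_cong) (auto simp: J_def f_def indicator_def mult.commute)
  also have "\<dots> = (\<integral>\<^sup>+w. h w \<partial>distr (density lborel J) borel f)"
    by (simp add: nn_integral_distr nn_integral_density)
  also have "\<dots> = (\<integral>\<^sup>+w\<in>\<phi> ` E. h w \<partial>lborel)"
    by (simp add: eq nn_integral_density mult.commute)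
  finally show ?thesis .
qed

lemma nn_integral_rotate:
  fixes c :: complex
  assumes "cmod c = 1" and "h \<in> borel_measurable borel"
  shows "(\<integral>\<^sup>+z\<in>ball 0 \<rho>. h (c * z) \<partial>lborel) = (\<integral>\<^sup>+z\<in>ball 0 \<rho>. h z \<partial>lborel)"
proof -
  have "c \<noteq> 0" using assms by auto
  have im: "(\<lambda>z. c * z) ` ball 0 \<rho> = ball 0 \<rho>"
  proof -
    have "w \<in> (\<lambda>z. c * z) ` ball 0 \<rho>" if "cmod w < \<rho>" for w
      using that assms \<open>c \<noteq> 0\<close> by (intro image_eqI[of _ _ "w / c"]) (auto simp: norm_divide)
    then show ?thesis using assms by (auto simp: norm_mult)
  qed
  have "deriv (\<lambda>z. c * z) z = c" for z
    by (intro DERIV_imp_deriv) (auto intro!: derivative_eq_intros)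
  then show ?thesis
    using nn_integral_holomorphic_image[of UNIV "\<lambda>z. c * z" "ball 0 \<rho>" h] assms \<open>c \<noteq> 0\<close>
    by (auto simp: im inj_on_def intro!: holomorphic_intros)
qed

section \<open>Area formula for noninjective maps\<close>

text \<open>The area formula for a holomorphic map that need not be injective: the domain minus the
  critical points splits into countably many Borel pieces on which the map is injective.\<close>

lemma countable_injective_partition:
  assumes "open S" "\<phi> holomorphic_on S"
  obtains B E :: "nat \<Rightarrow> complex set"
  where "\<And>i. open (B i)" "\<And>i. inj_on \<phi> (B i)" "\<And>i. E i \<in> sets borel" "\<And>i. E i \<subseteq> B i"
    "\<And>i. B i \<subseteq> S" "disjoint_family E" "(\<Union>i. E i) = {z \<in> S. deriv \<phi> z \<noteq> 0}"
proof -
  define R where "R = {z \<in> S. deriv \<phi> z \<noteq> 0}"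
  have "continuous_on S (deriv \<phi>)"
    using assms holomorphic_deriv holomorphic_on_imp_continuous_on by blast
  then have "openin (top_of_set S) (S \<inter> deriv \<phi> -` (- {0}))"
    by (intro continuous_openin_preimage_gen) auto
  moreover have "S \<inter> deriv \<phi> -` (- {0}) = R"
    by (auto simp: R_def)
  ultimately have oR: "open R"
    using assms(1) openin_open_trans by metis
  define F where "F = {b. open b \<and> b \<subseteq> R \<and> inj_on \<phi> b}"
  have "\<Union>F = R"
  proof
    show "R \<subseteq> \<Union>F"
    proof
      fix z assume z: "z \<in> R"
      have "\<phi> holomorphic_on R"
        using assms(2) by (rule holomorphic_on_subset) (auto simp: R_def)
      moreover have "deriv \<phi> z \<noteq> 0" using z by (simp add: R_def)
      ultimately obtain r where "r > 0" "ball z r \<subseteq> R" "inj_on \<phi> (ball z r)"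
        using has_complex_derivative_locally_injective[OF _ z oR] by metis
      then have "ball z r \<in> F" "z \<in> ball z r" by (auto simp: F_def)
      then show "z \<in> \<Union>F" by (rule UnionI)
    qed
  qed (auto simp: F_def)
  moreover have "\<And>b. b \<in> F \<Longrightarrow> open b" by (simp add: F_def)
  ultimately obtain F' where F': "F' \<subseteq> F" "countable F'" "\<Union>F' = R"
    using Lindelof[of F] by auto
  \<comment> \<open>Adding the empty set makes the family nonempty, so that it can be enumerated
    even when there are no regular points.\<close>
  define B where "B = from_nat_into (insert {} F')"
  have rB: "range B = insert {} F'"
    unfolding B_def using F' by (intro range_from_nat_into) auto
  have B: "open (B i)" "inj_on \<phi> (B i)" "B i \<subseteq> R" for i
  proof -
    have "B i \<in> insert {} F" using rB F'(1) by blast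
    then show "open (B i)" "inj_on \<phi> (B i)" "B i \<subseteq> R" by (auto simp: F_def)
  qed
  show thesis
  proof (rule that[of B "disjointed B"])
    have "range B \<subseteq> sets borel" using B by auto
    from sets.range_disjointed_sets[OF this] show "disjointed B i \<in> sets borel" for i
      by auto
    show "(\<Union>i. disjointed B i) = {z \<in> S. deriv \<phi> z \<noteq> 0}"
      using rB F'(3) by (simp add: UN_disjointed_eq R_def[symmetric])
    show "disjointed B i \<subseteq> B i" for i by (rule disjointed_subset)
    show "B i \<subseteq> S" for i using B(3)[of i] by (auto simp: R_def)
    show "disjoint_family (disjointed B)" by (rule disjoint_family_disjointed)
    show "open (B i)" for i by (rule B(1))
    show "inj_on \<phi> (B i)" for i by (rule B(2))
  qed
qed

text \<open>Noncritical preimages have multiplicity one, so for \<open>u\<close> the weight this is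
  the counting function restricted to them. Values lie in [0, \<infinity>] because a point may have
  infinitely many preimages.\<close>

definition regular_count :: "(complex \<Rightarrow> ennreal) \<Rightarrow> complex set \<Rightarrow> (complex \<Rightarrow> complex) \<Rightarrow> complex \<Rightarrow> ennreal" where
  "regular_count u S \<phi> w =
     (\<integral>\<^sup>+a. indicator {a \<in> S. \<phi> a = w \<and> deriv \<phi> a \<noteq> 0} a * u a \<partial>count_space UNIV)"

text \<open>On each injective piece a value has at most one preimage, so the count is a countable
  sum of Borel functions supported on the images of the pieces. This gives measurability, and
  summing the injective formula over the pieces gives the integral identity.\<close>

lemma area_formula:
  assumes S: "open S" "\<phi> holomorphic_on S" "bounded (\<phi> ` S)"
    and u[measurable]: "u \<in> borel_measurable borel" 
  shows borel_measurable_regular_count: "regular_count u S \<phi> \<in> borel_measurable borel" (is ?meas)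
    and nn_integral_regular_count:
    "h \<in> borel_measurable borel \<Longrightarrow>
       (\<integral>\<^sup>+z\<in>S. h (\<phi> z) * ennreal ((cmod (deriv \<phi> z))\<^sup>2) * u z \<partial>lborel) = (\<integral>\<^sup>+w. h w * regular_count u S \<phi> w \<partial>lborel)"
proof -
  obtain B E :: "nat \<Rightarrow> complex set"
  where B: "\<And>i. open (B i)" "\<And>i. inj_on \<phi> (B i)" "\<And>i. E i \<in> sets borel" "\<And>i. E i \<subseteq> B i"
    "\<And>i. B i \<subseteq> S" and dj: "disjoint_family E" and UE: "(\<Union>i. E i) = {z \<in> S. deriv \<phi> z \<noteq> 0}"
    using countable_injective_partition[OF S(1,2)] by blast
  have hB: "\<phi> holomorphic_on B i" for i
    using S(2) B(5) holomorphic_on_subset by blast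
  have bd: "bounded (\<phi> ` E i)" for i
    using S(3) by (rule bounded_subset) (use B in blast)
  have [measurable]: "\<phi> ` E i \<in> sets borel" "E i \<in> sets borel" for i
    using borel_image_holomorphic[OF B(1) hB B(2,3,4)] B(3) by blast+
  \<comment> \<open>The inverse branch is taken on the open set \<open>B i\<close>, where the image
    is open and the inverse holomorphic; extension by 0 makes it Borel on the plane.\<close>
  have "\<exists>g. g \<in> borel_measurable borel \<and> (\<forall>z\<in>B i. g (\<phi> z) = z)" for i
  proof -
    obtain g where g: "g holomorphic_on (\<phi> ` B i)" "\<And>z. z \<in> B i \<Longrightarrow> g (\<phi> z) = z"
      using holomorphic_has_inverse[OF hB B(1) B(2)] by metis
    have "open (\<phi> ` B i)"
      using open_mapping_thm3 B hB by blast
    then have "(\<lambda>w. if w \<in> \<phi> ` B i then g w else 0) \<in> borel_measurable borel"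
      by (intro borel_measurable_continuous_on_if continuous_on_const holomorphic_on_imp_continuous_on g) auto
    then show ?thesis
      using g(2) by (intro exI[of _ "\<lambda>w. if w \<in> \<phi> ` B i then g w else 0"]) auto
  qed
  then obtain \<psi> where \<psi>[measurable]: "\<And>i. \<psi> i \<in> borel_measurable borel" and \<psi>: "\<And>i z. z \<in> B i \<Longrightarrow> \<psi> i (\<phi> z) = z"
    by metis
  define v where "v i w = indicator (\<phi> ` E i) w * u (\<psi> i w)" for i w
  have [measurable]: "v i \<in> borel_measurable borel" for i
    unfolding v_def by measurable
  \<comment> \<open>The pieces omit the critical points, but there \<open>deriv \<phi> z\<close>
    vanishes and nothing is lost.\<close>
  have split: "indicator S z * ennreal ((cmod (deriv \<phi> z))\<^sup>2) = (\<Sum>i. ennreal ((cmod (deriv \<phi> z))\<^sup>2) * indicator (E i) z)" for z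
  proof (cases "\<exists>i. z \<in> E i")
    case True
    then obtain i where "z \<in> E i" by blast
    moreover from this have "z \<in> S" using B(4,5) by blast
    ultimately show ?thesis
      using suminf_cmult_indicator[OF dj, of z i "\<lambda>_. ennreal ((cmod (deriv \<phi> z))\<^sup>2)"] by (auto simp: indicator_def)
  next
    case False
    then show ?thesis
      using UE by (cases "z \<in> S") auto
  qed
  have n: "regular_count u S \<phi> w = (\<Sum>i. v i w)" for w
  proof -
    have "indicator {a \<in> S. \<phi> a = w \<and> deriv \<phi> a \<noteq> 0} a * u a
         = (\<Sum>i. (indicator {a. \<phi> a = w} a * u a) * indicator (E i) a)" for a
    proof (cases "\<exists>i. a \<in> E i")
      case True
      then obtain i where i: "a \<in> E i" by blast
      then have "a \<in> S" "deriv \<phi> a \<noteq> 0" using UE by blast+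
      then show ?thesis
        using suminf_cmult_indicator[OF dj i, of "\<lambda>_. indicator {a. \<phi> a = w} a * u a"] by (auto simp: indicator_def)
    next
      case False
      then have "\<not> (a \<in> S \<and> deriv \<phi> a \<noteq> 0)" using UE by blast
      then show ?thesis using False by (auto simp: indicator_def)
    qed
    then have "regular_count u S \<phi> w = (\<Sum>i. \<integral>\<^sup>+a. (indicator {a. \<phi> a = w} a * u a) * indicator (E i) a \<partial>count_space UNIV)"
      unfolding regular_count_def by (simp only:) (subst nn_integral_suminf, auto)
    moreover have "(\<integral>\<^sup>+a. (indicator {a. \<phi> a = w} a * u a) * indicator (E i) a \<partial>count_space UNIV) = v i w" for i
    proof (cases "w \<in> \<phi> ` E i")
      case True
      then obtain b where b: "b \<in> E i" "w = \<phi> b" by blast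
      have "indicator {a. \<phi> a = w} a * u a * indicator (E i) a = u a * indicator {b} a" for a
        using b B(2)[of i] B(4)[of i] by (auto simp: indicator_def inj_on_def)
      then show ?thesis
        using b \<psi>[of b i] B(4)[of i] by (auto simp: v_def)
    next
      case False
      then have z: "indicator {a. \<phi> a = w} a * u a * indicator (E i) a = 0" for a
        by (auto simp: indicator_def)
      show ?thesis unfolding z using False by (simp add: v_def)
    qed
    ultimately show ?thesis by simp
  qed
  show ?meas
    unfolding n[abs_def] by measurable
  assume h[measurable]: "h \<in> borel_measurable borel"
  have piece: "(\<integral>\<^sup>+z\<in>E i. h (\<phi> z) * ennreal ((cmod (deriv \<phi> z))\<^sup>2) * u z \<partial>lborel) = (\<integral>\<^sup>+w. h w * v i w \<partial>lborel)" for i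
  proof -
    have "(\<integral>\<^sup>+z\<in>E i. h (\<phi> z) * ennreal ((cmod (deriv \<phi> z))\<^sup>2) * u z \<partial>lborel)
       = (\<integral>\<^sup>+z\<in>E i. (h (\<phi> z) * u (\<psi> i (\<phi> z))) * ennreal ((cmod (deriv \<phi> z))\<^sup>2) \<partial>lborel)"
      using \<psi>[of _ i] B(4)[of i] by (intro nn_integral_cong) (auto simp: indicator_def mult_ac)
    also have "\<dots> = (\<integral>\<^sup>+w\<in>\<phi> ` E i. h w * u (\<psi> i w) \<partial>lborel)"
      by (rule nn_integral_holomorphic_image[OF B(1) hB B(2,3,4) bd]) measurable
    finally show ?thesis
      by (simp add: v_def mult_ac)
  qed
  \<comment> \<open>Nothing is known about \<phi> outside \<open>S\<close>, so the integrand is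
    first rewritten with \<phi> and its derivative cut off at \<open>S\<close>.\<close>
  have mE: "(\<lambda>z. h (\<phi> z) * ennreal ((cmod (deriv \<phi> z))\<^sup>2) * u z * indicator (E i) z) \<in> borel_measurable borel" for i
  proof -
    have "continuous_on S (deriv \<phi>)"
      using S holomorphic_deriv holomorphic_on_imp_continuous_on by blast
    then have 1: "(\<lambda>z. indicator S z * (cmod (deriv \<phi> z))\<^sup>2) \<in> borel_measurable borel"
      by (intro borel_measurable_indicator_mult continuous_intros) (use S in auto)
    have 2: "(\<lambda>z. if z \<in> S then \<phi> z else 0) \<in> borel_measurable borel"
      using S by (intro borel_measurable_continuous_on_if continuous_on_const holomorphic_on_imp_continuous_on) auto
    have "(\<lambda>z. h (if z \<in> S then \<phi> z else 0) * ennreal (indicator S z * (cmod (deriv \<phi> z))\<^sup>2) * u z * indicator (E i) z) \<in> borel_measurable borel"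
      using 1 2 by measurable
    also have "(\<lambda>z. h (if z \<in> S then \<phi> z else 0) * ennreal (indicator S z * (cmod (deriv \<phi> z))\<^sup>2) * u z * indicator (E i) z)
       = (\<lambda>z. h (\<phi> z) * ennreal ((cmod (deriv \<phi> z))\<^sup>2) * u z * indicator (E i) z)"
      using B(4)[of i] B(5)[of i] by (intro ext) (auto simp: indicator_def)
    finally show ?thesis .
  qed
  have "(\<integral>\<^sup>+z\<in>S. h (\<phi> z) * ennreal ((cmod (deriv \<phi> z))\<^sup>2) * u z \<partial>lborel) =
     (\<integral>\<^sup>+z. h (\<phi> z) * u z * (\<Sum>i. ennreal ((cmod (deriv \<phi> z))\<^sup>2) * indicator (E i) z) \<partial>lborel)"
    unfolding split[symmetric] by (simp add: mult_ac)
  also have "\<dots> = (\<integral>\<^sup>+z. (\<Sum>i. h (\<phi> z) * ennreal ((cmod (deriv \<phi> z))\<^sup>2) * u z * indicator (E i) z) \<partial>lborel)"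
    unfolding ennreal_suminf_cmult[symmetric] by (simp only: mult_ac)
  also have "\<dots> = (\<Sum>i. \<integral>\<^sup>+w. h w * v i w \<partial>lborel)"
    using mE by (subst nn_integral_suminf) (auto simp: piece)
  also have "\<dots> = (\<integral>\<^sup>+w. h w * regular_count u S \<phi> w \<partial>lborel)"
    unfolding n ennreal_suminf_cmult[symmetric] by (subst nn_integral_suminf) auto
  finally show "(\<integral>\<^sup>+z\<in>S. h (\<phi> z) * ennreal ((cmod (deriv \<phi> z))\<^sup>2) * u z \<partial>lborel) = (\<integral>\<^sup>+w. h w * regular_count u S \<phi> w \<partial>lborel)" .
qed

section \<open>The counting function almost everywhere\<close>

lemma zero_mult_eq_1:
  assumes "deriv \<phi> a \<noteq> 0"
  shows "zero_mult \<phi> a = 1"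
  unfolding zero_mult_def using assms by (intro Least_equality) auto

text \<open>The two counts can differ only at \<open>\<phi> 0\<close> and at critical values. Unless
  \<phi> is constant, its critical points are countable, so these values form a null set.\<close>

lemma AE_Ncount_eq_regular_count:
  assumes hol: "\<phi> holomorphic_on ball 0 1"
  shows "AE w in lborel. Ncount \<omega> \<phi> w = regular_count (\<lambda>a. ennreal (\<omega> (cmod a))) (ball 0 1) \<phi> w"
proof (cases "\<forall>z\<in>ball 0 1. deriv \<phi> z = 0")
  case True
  then have c: "\<phi> z = \<phi> 0" if "z \<in> ball 0 1" for z
  proof -
    have "(\<phi> has_field_derivative 0) (at x within ball 0 1)" if "x \<in> ball 0 1" for x
      using holomorphic_derivI[OF hol open_ball that] True that by (metis has_field_derivative_at_within)
    then obtain c where "\<And>x. x \<in> ball 0 1 \<Longrightarrow> \<phi> x = c"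
      using has_field_derivative_zero_constant[of "ball 0 1" \<phi>] by auto
    then show ?thesis using that by simp
  qed
  \<comment> \<open>A constant map takes only the value \<open>\<phi> 0\<close>, where
    \<open>Ncount\<close> is 0 by convention, so its meaningless multiplicities never
    contribute.\<close>
  have "Ncount \<omega> \<phi> w = 0" for w
  proof (cases "w = \<phi> 0")
    case False
    then have "{a \<in> ball 0 1. \<phi> a = w} = {}" using c False by blast
    then show ?thesis by (simp add: Ncount_def)
  qed (simp add: Ncount_def)
  moreover have "regular_count u (ball 0 1) \<phi> w = 0" for u w
  proof -
    have "{a \<in> ball 0 1. \<phi> a = w \<and> deriv \<phi> a \<noteq> 0} = {}" using True by auto
    then show ?thesis by (simp add: regular_count_def)
  qed
  ultimately show ?thesis by simp
next
  case False
  define Z where "Z = {z \<in> ball 0 1. deriv \<phi> z = 0}"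
  have "countable Z"
  \<comment> \<open>A constant derivative is nonzero here and leaves no critical points; otherwise
    the zeros of the nonconstant derivative are countable.\<close>
  proof (cases "deriv \<phi> constant_on ball 0 1")
    case True
    then have "Z = {}" using False by (force simp: Z_def constant_on_def)
    then show ?thesis by simp
  next
    case False
    have "fsigma (ball (0::complex) 1)"
    proof -
      obtain C :: "nat \<Rightarrow> complex set" where "\<And>n. compact (C n)" "\<Union>(range C) = ball 0 1"
        by (metis open_ball open_Union_compact_subsets)
      then show ?thesis
        unfolding fsigma_Union_compact by (intro exI[of _ C]) auto
    qed
    then show ?thesis
      unfolding Z_def using False by (intro holomorphic_countable_zeros holomorphic_deriv hol) auto
  qed
  then have "countable (insert (\<phi> 0) (\<phi> ` Z))" by simp
  then have "AE w in lborel. w \<notin> insert (\<phi> 0) (\<phi> ` Z)"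
    by (intro AE_not_in countable_imp_null_set_lborel)
  then show ?thesis
  proof eventually_elim
    case (elim w)
    then have "indicator {a \<in> ball 0 1. \<phi> a = w} a * ennreal (real (zero_mult \<phi> a) * \<omega> (cmod a))
      = indicator {a \<in> ball 0 1. \<phi> a = w \<and> deriv \<phi> a \<noteq> 0} a * ennreal (\<omega> (cmod a))" for a
      using zero_mult_eq_1[of \<phi> a] by (auto simp: indicator_def Z_def)
    then show ?case
      using elim by (simp add: Ncount_def regular_count_def)
  qed
qed

section \<open>Mean value inequality on discs\<close>

text \<open>Cauchy's formula on the unit circle for \<open>F v = G (a + u * v)\<close>, followed by
  the triangle inequality. With \<open>u\<close> complex instead of a radius, the inequality can
  later be integrated over all \<open>u\<close> in a disc.\<close>

lemma cmod_le_circle_mean: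
  assumes hol: "G holomorphic_on ball a \<rho>" and u: "cmod u < \<rho>"
  shows "ennreal (cmod (G a)) \<le> (\<integral>\<^sup>+x\<in>{0..1}. ennreal (cmod (G (a + u * exp (2 * of_real pi * \<i> * of_real x)))) \<partial>lborel)"
proof -
  define F where "F v = G (a + u * v)" for v
  define e where "e x = exp (2 * of_real pi * \<i> * of_real x)" for x :: real
  have sub: "(\<lambda>v. a + u * v) ` cball 0 1 \<subseteq> ball a \<rho>"
    using u by (auto simp: dist_norm norm_mult) (smt (verit) mult_left_le norm_ge_zero)
  have "F holomorphic_on cball 0 1"
    unfolding F_def
    by (rule holomorphic_on_compose_gen[unfolded o_def, OF _ hol sub]) (intro holomorphic_intros)
  from Cauchy_integral_circlepath_simple[OF this, of 0]
  have "((\<lambda>u. F u / u) has_contour_integral 2 * of_real pi * \<i> * F 0) (circlepath 0 1)"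
    by simp
  then have "((\<lambda>x. F (e x) / e x * (2 * of_real pi * \<i> * e x)) has_integral 2 * of_real pi * \<i> * F 0) {0..1}"
    unfolding has_contour_integral_def
  proof (rule has_integral_eq[rotated])
    fix x :: real assume "x \<in> {0..1}"
    then have "vector_derivative (circlepath 0 1) (at x within {0..1}) = 2 * of_real pi * \<i> * e x"
      using vector_derivative_circlepath01[of x 0 1] by (simp add: e_def)
    moreover have "circlepath 0 1 x = e x" by (simp add: circlepath e_def)
    ultimately show "F (circlepath 0 1 x) / circlepath 0 1 x * vector_derivative (circlepath 0 1) (at x within {0..1})
      = F (e x) / e x * (2 * of_real pi * \<i> * e x)" by simp
  qed
  moreover have "F (e x) / e x * (2 * of_real pi * \<i> * e x) = (2 * of_real pi * \<i>) * F (e x)" for x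
    by (simp add: e_def)
  ultimately have "((\<lambda>x. (2 * of_real pi * \<i>) * F (e x)) has_integral 2 * of_real pi * \<i> * F 0) {0..1}"
    by simp
  from has_integral_mult_right[OF this, of "1 / (2 * of_real pi * \<i>)"]
  have F0: "((\<lambda>x. F (e x)) has_integral F 0) {0..1}" by simp
  have cont: "continuous_on {0..1} (\<lambda>x. cmod (F (e x)))"
  proof -
    have "continuous_on (cball 0 1) F"
      using \<open>F holomorphic_on cball 0 1\<close> holomorphic_on_imp_continuous_on by blast
    moreover have "e ` {0..1} \<subseteq> cball 0 1"
      by (auto simp: e_def norm_exp_eq_Re)
    moreover have "continuous_on {0..1} e"
      unfolding e_def by (intro continuous_intros)
    ultimately have "continuous_on {0..1} (\<lambda>x. F (e x))"
      using continuous_on_compose2 by blast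
    then show ?thesis by (intro continuous_intros)
  qed
  then have int: "(\<lambda>x. cmod (F (e x))) integrable_on {0..1}"
    using integrable_continuous_interval by blast
  define I where "I = integral {0..1} (\<lambda>x. cmod (F (e x)))"
  have "((\<lambda>x. indicator {0..1} x * cmod (F (e x))) has_integral I) UNIV"
    using integrable_integral[OF int] unfolding I_def
    by (subst (asm) has_integral_restrict_UNIV[symmetric]) (erule has_integral_eq[rotated], auto)
  then have "(\<integral>\<^sup>+x. ennreal (indicator {0..1} x * cmod (F (e x))) \<partial>lborel) = ennreal I"
    by (intro nn_integral_has_integral_lborel borel_measurable_indicator_mult cont) auto
  moreover have "cmod (F 0) \<le> I"
    unfolding I_def using F0 int
    by (metis integral_norm_bound_integral has_integral_integrable integral_unique order_refl)
  ultimately have "ennreal (cmod (F 0)) \<le> (\<integral>\<^sup>+x. ennreal (indicator {0..1} x * cmod (F (e x))) \<partial>lborel)"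
    by (simp add: ennreal_leI)
  then show ?thesis
    unfolding nn_integral_set_ennreal by (simp add: F_def e_def mult.commute)
qed

text \<open>Averaging the circle mean value inequality over all rotations of the disc replaces polar
  coordinates.\<close>

lemma cmod_square_le_disc_mean:
  assumes hol: "g holomorphic_on ball a \<rho>" and "\<rho> > 0"
  shows "ennreal ((cmod (g a))\<^sup>2) * ennreal (pi * \<rho>\<^sup>2) \<le> (\<integral>\<^sup>+w\<in>ball a \<rho>. ennreal ((cmod (g w))\<^sup>2) \<partial>lborel)"
proof -
  define e where "e x = exp (2 * of_real pi * \<i> * of_real x)" for x :: real
  have [measurable]: "e \<in> borel_measurable borel"
    unfolding e_def by (intro borel_measurable_continuous_onI continuous_intros)
  have [measurable]: "ball (0::complex) \<rho> \<in> sets borel" by simp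
  have ne: "cmod (e x) = 1" for x by (simp add: e_def norm_exp_eq_Re)
  define H where "H v = ennreal (indicator (ball 0 \<rho>) v * (cmod (g (a + v)))\<^sup>2)" for v
  have "continuous_on (ball 0 \<rho>) (\<lambda>v. (cmod (g (a + v)))\<^sup>2)"
    by (intro continuous_intros continuous_on_compose2[OF holomorphic_on_imp_continuous_on[OF hol]])
       (auto simp: dist_norm)
  then have H[measurable]: "H \<in> borel_measurable borel"
    unfolding H_def
    by (intro measurable_compose[OF _ measurable_ennreal] borel_measurable_indicator_mult) auto
  \<comment> \<open>The circle mean of the holomorphic square of \<open>g\<close> already bounds the
    squared modulus.\<close>
  have hol2: "(\<lambda>z. (g z)\<^sup>2) holomorphic_on ball a \<rho>"
    by (intro holomorphic_intros hol)
  have pw: "ennreal ((cmod (g a))\<^sup>2) \<le> (\<integral>\<^sup>+x\<in>{0..1}. H (e x * u) \<partial>lborel)" if "u \<in> ball 0 \<rho>" for u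
  proof -
    have "ennreal (cmod ((g a)\<^sup>2)) \<le> (\<integral>\<^sup>+x\<in>{0..1}. ennreal (cmod ((g (a + u * e x))\<^sup>2)) \<partial>lborel)"
      using cmod_le_circle_mean[OF hol2, of u] that by (simp add: e_def)
    then show ?thesis
      using that by (simp add: H_def norm_mult ne norm_power mult.commute)
  qed
  have "ennreal ((cmod (g a))\<^sup>2) * ennreal (pi * \<rho>\<^sup>2) = (\<integral>\<^sup>+u\<in>ball (0::complex) \<rho>. ennreal ((cmod (g a))\<^sup>2) \<partial>lborel)"
    using \<open>\<rho> > 0\<close> by (subst nn_integral_cmult_indicator) (auto simp: emeasure_ball unit_ball_vol_2)
  also have "\<dots> \<le> (\<integral>\<^sup>+u\<in>ball 0 \<rho>. (\<integral>\<^sup>+x\<in>{0..1}. H (e x * u) \<partial>lborel) \<partial>lborel)"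
    using pw by (intro nn_integral_mono) (auto simp: indicator_def)
  also have "\<dots> = (\<integral>\<^sup>+u. (\<integral>\<^sup>+x. H (e x * u) * indicator {0..1} x * indicator (ball 0 \<rho>) u \<partial>lborel) \<partial>lborel)"
    by (subst nn_integral_multc[symmetric]) auto
  also have "\<dots> = (\<integral>\<^sup>+x. (\<integral>\<^sup>+u. H (e x * u) * indicator {0..1} x * indicator (ball 0 \<rho>) u \<partial>lborel) \<partial>lborel)"
    by (rule lborel_pair.Fubini') measurable
  also have "\<dots> = (\<integral>\<^sup>+x. (\<integral>\<^sup>+u\<in>ball 0 \<rho>. H (e x * u) \<partial>lborel) * indicator {0..1} x \<partial>lborel)"
    by (subst nn_integral_multc[symmetric]) (auto simp: mult_ac)
  \<comment> \<open>For each fixed angle the rotation preserves the integral over the disc, so the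
    outer average over \<open>x\<close> becomes trivial.\<close>
  also have "\<dots> = (\<integral>\<^sup>+x. (\<integral>\<^sup>+u\<in>ball 0 \<rho>. H u \<partial>lborel) * indicator {0..1::real} x \<partial>lborel)"
    using nn_integral_rotate[OF ne H] by simp
  also have "\<dots> = (\<integral>\<^sup>+u\<in>ball 0 \<rho>. H u \<partial>lborel)"
    by (subst nn_integral_cmult_indicator) auto
  also have "\<dots> = (\<integral>\<^sup>+u\<in>ball 0 \<rho>. (H (a + u - a)) * ennreal ((cmod (deriv (\<lambda>z. a + z) u))\<^sup>2) \<partial>lborel)"
  proof -
    have "deriv (\<lambda>z. a + z) u = 1" for u
      by (intro DERIV_imp_deriv) (auto intro!: derivative_eq_intros)
    then show ?thesis by simp
  qed
  also have "\<dots> = (\<integral>\<^sup>+w\<in>(\<lambda>z. a + z) ` ball 0 \<rho>. H (w - a) \<partial>lborel)"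
  proof -
    have "bounded ((+) a ` ball 0 \<rho>)" by (simp add: bounded_translation)
    then show ?thesis
      by (intro nn_integral_holomorphic_image[of UNIV]) (auto intro!: holomorphic_intros)
  qed
  also have "(\<lambda>z. a + z) ` ball 0 \<rho> = ball a \<rho>"
    by simp
  also have "(\<integral>\<^sup>+w\<in>ball a \<rho>. H (w - a) \<partial>lborel) = (\<integral>\<^sup>+w\<in>ball a \<rho>. ennreal ((cmod (g w))\<^sup>2) \<partial>lborel)"
    by (intro nn_integral_cong) (auto simp: H_def indicator_def dist_norm norm_minus_commute)
  finally show ?thesis .
qed

lemma ennreal_divide_le_iff:
  assumes "0 < c"
  shows "x / ennreal c \<le> y \<longleftrightarrow> x \<le> y * ennreal c"
proof
  assume "x / ennreal c \<le> y"
  then have "x / ennreal c * ennreal c \<le> y * ennreal c"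
    by (rule mult_right_mono) simp
  then show "x \<le> y * ennreal c"
    using assms by (simp add: ennreal_divide_times ennreal_divide_self)
next
  assume "x \<le> y * ennreal c"
  then show "x / ennreal c \<le> y"
    using assms by (intro divide_le_posI_ennreal) (auto simp: mult.commute)
qed

section \<open>Weights obeying a power law\<close>

text \<open>With monotonicity, the last condition makes the weight comparable at points of
  comparable distance to the circle, and bounds its growth towards the centre by a power of the
  ratio of distances. A natural \<open>q\<close> keeps the matching kernels single-valued.\<close>

locale doubling_weight =
  fixes \<omega> :: "real \<Rightarrow> real" and q :: nat
  assumes pos: "0 \<le> r \<Longrightarrow> r < 1 \<Longrightarrow> 0 < \<omega> r"
    and antimono: "0 \<le> x \<Longrightarrow> x \<le> y \<Longrightarrow> y < 1 \<Longrightarrow> \<omega> y \<le> \<omega> x"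
    and cont: "continuous_on {0..<1} \<omega>"
    and doubling: "0 \<le> x \<Longrightarrow> x \<le> y \<Longrightarrow> y < 1 \<Longrightarrow> \<omega> x \<le> \<omega> y * ((1 - x) / (1 - y)) ^ (2 * q)"

text \<open>(W2) is the power law with exponent \<open>1 + \<delta>\<close>. The ratio of distances
  is at least 1, so the exponent may be enlarged to an even integer.\<close>

lemma admissible_II_doubling_weight:
  assumes "admissible_II \<omega>"
  obtains q where "doubling_weight \<omega> q"
proof -
  obtain \<delta> where \<delta>: "\<delta> > 0" "\<And>x y. 0 \<le> x \<Longrightarrow> x \<le> y \<Longrightarrow> y < 1 \<Longrightarrow>
        \<omega> x * (1 - x) powr (-(1 + \<delta>)) \<le> \<omega> y * (1 - y) powr (-(1 + \<delta>))"
    using assms unfolding admissible_II_def by blast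
  obtain q :: nat where q: "1 + \<delta> \<le> real q"
    using real_arch_simple by blast
  have pos: "0 < \<omega> r" if "0 \<le> r" "r < 1" for r
    using assms that by (auto simp: admissible_II_def weight_function_def)
  have "doubling_weight \<omega> q"
  proof
    show "0 < \<omega> r" if "0 \<le> r" "r < 1" for r by (rule pos[OF that])
    show "\<omega> y \<le> \<omega> x" if "0 \<le> x" "x \<le> y" "y < 1" for x y
      using assms that by (auto simp: admissible_II_def)
    obtain \<omega>1 where "\<And>r. r \<in> {0..<1} \<Longrightarrow> (\<omega> has_real_derivative \<omega>1 r) (at r within {0..<1})"
      using assms unfolding admissible_II_def weight_function_def by blast
    then show "continuous_on {0..<1} \<omega>"
      by (meson DERIV_continuous continuous_on_eq_continuous_within)
    show "\<omega> x \<le> \<omega> y * ((1 - x) / (1 - y)) ^ (2 * q)" if xy: "0 \<le> x" "x \<le> y" "y < 1" for x y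
    proof -
      have t: "1 \<le> (1 - x) / (1 - y)" using xy by simp
      have "\<omega> x = \<omega> x * (1 - x) powr (-(1 + \<delta>)) * (1 - x) powr (1 + \<delta>)"
        using xy by (simp add: mult.assoc flip: powr_add)
      also have "\<dots> \<le> \<omega> y * (1 - y) powr (-(1 + \<delta>)) * (1 - x) powr (1 + \<delta>)"
        by (intro mult_right_mono \<delta> xy) auto
      also have "\<dots> = \<omega> y * ((1 - x) / (1 - y)) powr (1 + \<delta>)"
        using xy by (simp only: powr_minus_divide) (simp add: powr_divide)
      also have "\<dots> \<le> \<omega> y * ((1 - x) / (1 - y)) powr (real (2 * q))"
        using t q pos[of y] xy by (intro mult_left_mono powr_mono) auto
      also have "\<dots> = \<omega> y * ((1 - x) / (1 - y)) ^ (2 * q)"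
        using t by (subst powr_realpow) auto
      finally show ?thesis .
    qed
  qed
  then show thesis by (rule that)
qed

context doubling_weight
begin

text \<open>The cut-off makes the radial weight Borel on the whole plane, whatever values \<omega>
  takes outside [0,1).\<close>

definition disc_weight :: "complex \<Rightarrow> ennreal" where
  "disc_weight z = ennreal (indicator (ball 0 1) z * \<omega> (cmod z))"

lemma borel_measurable_disc_weight [measurable]: "disc_weight \<in> borel_measurable borel"
proof -
  have "continuous_on (ball 0 1) (\<lambda>z::complex. \<omega> (cmod z))"
    by (rule continuous_on_compose2[OF cont]) (auto intro!: continuous_intros)
  then show ?thesis
    unfolding disc_weight_def
    by (intro measurable_compose[OF _ measurable_ennreal] borel_measurable_indicator_mult) auto
qed

lemma Dint_eq:
  "Dint \<omega> f = (\<integral>\<^sup>+z\<in>ball 0 1. ennreal ((cmod (deriv f z))\<^sup>2) * disc_weight z \<partial>lborel) / ennreal pi"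
proof -
  have "ennreal ((cmod (deriv f z))\<^sup>2 * \<omega> (cmod z)) * indicator (ball 0 1) z
     = ennreal ((cmod (deriv f z))\<^sup>2) * disc_weight z * indicator (ball 0 1) z" for z
    using pos[of "cmod z"] by (auto simp: disc_weight_def indicator_def ennreal_mult)
  then show ?thesis by (simp add: Dint_def)
qed

end

section \<open>Dirichlet integrals of compositions\<close>

lemma borel_measurable_holomorphic_cmod_square:
  assumes "g holomorphic_on ball 0 1"
  shows "(\<lambda>w. ennreal (indicator (ball 0 1) w * (cmod (g w))\<^sup>2)) \<in> borel_measurable borel"
  by (intro measurable_compose[OF _ measurable_ennreal] borel_measurable_indicator_mult
      continuous_intros holomorphic_on_imp_continuous_on assms) auto

locale composition_symbol = doubling_weight +
  fixes \<phi> :: "complex \<Rightarrow> complex"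
  assumes hol: "\<phi> holomorphic_on ball 0 1" and range: "\<phi> ` ball 0 1 \<subseteq> ball 0 1"
    and symbol_in_Hw: "\<phi> \<in> Hw \<omega>"
begin

text \<open>A Borel representative of the counting function; it replaces \<open>Ncount\<close> in
  every integral below.\<close>

definition count_density :: "complex \<Rightarrow> ennreal" where
  "count_density = regular_count disc_weight (ball 0 1) \<phi>"

lemma bounded_range: "bounded (\<phi> ` ball 0 1)"
  using range bounded_ball bounded_subset by blast

lemma borel_measurable_count_density [measurable]: "count_density \<in> borel_measurable borel"
  unfolding count_density_def
  by (rule borel_measurable_regular_count[OF open_ball hol bounded_range]) measurable

lemma AE_Ncount: "AE w in lborel. Ncount \<omega> \<phi> w = count_density w"
proof -
  have "regular_count (\<lambda>a. ennreal (\<omega> (cmod a))) (ball 0 1) \<phi> w = count_density w" for w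
    unfolding count_density_def regular_count_def disc_weight_def
    by (intro nn_integral_cong) (auto simp: indicator_def)
  then show ?thesis using AE_Ncount_eq_regular_count[OF hol, of \<omega>] by simp
qed

lemma carleson_quot_eq:
  "carleson_quot \<omega> \<phi> \<delta> \<zeta> =
     ((\<integral>\<^sup>+ z \<in> {z \<in> ball 0 1. cmod (z - \<zeta>) < \<delta>}. count_density z \<partial>lborel) / ennreal pi)
     / ennreal (\<delta>\<^sup>2 * \<omega> (1 - \<delta>))"
proof -
  have "(\<integral>\<^sup>+ z \<in> {z \<in> ball 0 1. cmod (z - \<zeta>) < \<delta>}. Ncount \<omega> \<phi> z \<partial>lborel)
      = (\<integral>\<^sup>+ z \<in> {z \<in> ball 0 1. cmod (z - \<zeta>) < \<delta>}. count_density z \<partial>lborel)"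
    by (rule nn_integral_cong_AE) (use AE_Ncount in eventually_elim, simp)
  then show ?thesis by (simp add: carleson_quot_def)
qed

lemma holomorphic_comp: "f holomorphic_on ball 0 1 \<Longrightarrow> f \<circ> \<phi> holomorphic_on ball 0 1"
  using holomorphic_on_compose_gen[OF hol _ range] by blast

lemma deriv_comp:
  assumes f: "f holomorphic_on ball 0 1" and z: "z \<in> ball 0 1"
  shows "deriv (f \<circ> \<phi>) z = deriv f (\<phi> z) * deriv \<phi> z"
proof -
  have "\<phi> z \<in> ball 0 1" using range z by blast
  then show ?thesis
    using z hol f by (intro deriv_chain) (auto simp: holomorphic_on_imp_differentiable_at)
qed

lemma Dint_comp:
  assumes f: "f holomorphic_on ball 0 1"
  shows "Dint \<omega> (f \<circ> \<phi>) = (\<integral>\<^sup>+w. ennreal (indicator (ball 0 1) w * (cmod (deriv f w))\<^sup>2) * count_density w \<partial>lborel) / ennreal pi"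
proof -
  define h where "h w = ennreal (indicator (ball 0 1) w * (cmod (deriv f w))\<^sup>2)" for w
  have h: "h \<in> borel_measurable borel"
    unfolding h_def by (intro borel_measurable_holomorphic_cmod_square holomorphic_deriv f) auto
  have "(\<integral>\<^sup>+z\<in>ball 0 1. ennreal ((cmod (deriv (f \<circ> \<phi>) z))\<^sup>2) * disc_weight z \<partial>lborel) =
     (\<integral>\<^sup>+z\<in>ball 0 1. h (\<phi> z) * ennreal ((cmod (deriv \<phi> z))\<^sup>2) * disc_weight z \<partial>lborel)"
  proof (intro nn_integral_cong)
    fix z
    show "ennreal ((cmod (deriv (f \<circ> \<phi>) z))\<^sup>2) * disc_weight z * indicator (ball 0 1) z =
      h (\<phi> z) * ennreal ((cmod (deriv \<phi> z))\<^sup>2) * disc_weight z * indicator (ball 0 1) z"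
    proof (cases "z \<in> ball 0 1")
      case True
      then have "\<phi> z \<in> ball 0 1" using range by blast
      then have "h (\<phi> z) = ennreal ((cmod (deriv f (\<phi> z)))\<^sup>2)" by (simp add: h_def)
      then show ?thesis
        by (simp add: deriv_comp[OF f True] norm_mult power_mult_distrib ennreal_mult)
    qed simp
  qed
  also have "\<dots> = (\<integral>\<^sup>+w. h w * count_density w \<partial>lborel)"
    unfolding count_density_def
    by (rule nn_integral_regular_count[OF open_ball hol bounded_range _ h]) measurable
  finally show ?thesis
    by (simp add: Dint_eq h_def)
qed

definition total_mass :: ennreal where
  "total_mass = (\<integral>\<^sup>+w\<in>ball 0 1. count_density w \<partial>lborel)"

text \<open>For the identity function, \<open>Dint_comp\<close> says that the total mass is \<pi>
  times the Dirichlet integral of \<phi>.\<close>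

lemma total_mass_finite: "total_mass < \<infinity>"
proof -
  have "(\<lambda>w. w) \<circ> \<phi> = \<phi>" by auto
  then have "Dint \<omega> \<phi> = total_mass / ennreal pi"
    using Dint_comp[of "\<lambda>w. w"] by (auto simp: total_mass_def mult.commute ennreal_indicator)
  moreover have "Dint \<omega> \<phi> < \<infinity>" using symbol_in_Hw by (simp add: Hw_def)
  ultimately have "total_mass \<le> Dint \<omega> \<phi> * ennreal pi" "Dint \<omega> \<phi> * ennreal pi < \<infinity>"
    using ennreal_divide_le_iff[of pi total_mass "Dint \<omega> \<phi>"] by (auto simp: ennreal_mult_less_top)
  then show ?thesis by (rule le_less_trans)
qed

section \<open>Carleson embedding\<close>

text \<open>Each value of g is replaced by its mean over a disc of radius comparable to the distance to
  the circle, and Tonelli moves the averaging onto the measure.\<close>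

lemma carleson_embedding:
  assumes g: "g holomorphic_on ball 0 1" and r: "1/2 \<le> r" "r < 1"
    and Q: "\<And>\<delta> \<zeta>. 0 < \<delta> \<Longrightarrow> \<delta> < 2 * (1 - r) \<Longrightarrow> cmod \<zeta> = 1 \<Longrightarrow> carleson_quot \<omega> \<phi> \<delta> \<zeta> \<le> ennreal Q"
    and "0 \<le> Q"
  defines "G \<equiv> \<lambda>w. ennreal (indicator (ball 0 1) w * (cmod (g w))\<^sup>2)"
  shows "(\<integral>\<^sup>+w. G w * count_density w \<partial>lborel) \<le>
    ennreal (36 * 4 ^ q * Q) * (\<integral>\<^sup>+w. G w * disc_weight w \<partial>lborel)
    + ennreal (9 / (pi * (1 - r)\<^sup>2)) * total_mass * (\<integral>\<^sup>+w\<in>cball 0 r. G w \<partial>lborel)"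
proof -
  have [measurable]: "G \<in> borel_measurable borel"
    unfolding G_def by (rule borel_measurable_holomorphic_cmod_square[OF g])
  have [measurable]: "cball (0::complex) r \<in> sets borel" by simp
  \<comment> \<open>The normalised indicator of the averaging disc about \<open>z\<close> of radius
    \<open>(1 - cmod z) / 2\<close>, as a function of \<open>w\<close>; the value is the reciprocal
    of its area.\<close>
  define k where "k w z = (if cmod z < 1 \<and> cmod (z - w) < (1 - cmod z) / 2 then ennreal (4 / (pi * (1 - cmod z)\<^sup>2)) else 0)"
    for w z :: complex
  have [measurable]: "case_prod k \<in> borel_measurable (borel \<Otimes>\<^sub>M borel)"
    unfolding k_def split_beta by measurable
  have mean: "G z * count_density z \<le> (\<integral>\<^sup>+w. count_density z * k w z * G w \<partial>lborel)" for z
  proof (cases "z \<in> ball 0 1")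
    case True
    define \<rho> where "\<rho> = (1 - cmod z) / 2"
    have [measurable]: "ball z \<rho> \<in> sets borel" by simp
    have \<rho>: "\<rho> > 0" using True by (simp add: \<rho>_def)
    have sub: "ball z \<rho> \<subseteq> ball 0 1"
    proof
      fix w assume "w \<in> ball z \<rho>"
      then have "cmod (z - w) < \<rho>" by (simp add: dist_norm)
      moreover have "cmod w \<le> cmod z + cmod (z - w)"
        by (metis add.commute norm_minus_commute norm_triangle_sub)
      ultimately show "w \<in> ball 0 1" using True by (simp add: \<rho>_def field_simps)
    qed
    have "ennreal ((cmod (g z))\<^sup>2) * ennreal (pi * \<rho>\<^sup>2) \<le> (\<integral>\<^sup>+w\<in>ball z \<rho>. ennreal ((cmod (g w))\<^sup>2) \<partial>lborel)"
      by (rule cmod_square_le_disc_mean[OF holomorphic_on_subset[OF g sub] \<rho>])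
    then have "ennreal ((cmod (g z))\<^sup>2) \<le> (\<integral>\<^sup>+w\<in>ball z \<rho>. ennreal ((cmod (g w))\<^sup>2) \<partial>lborel) * ennreal (1 / (pi * \<rho>\<^sup>2))"
      using \<rho> ennreal_divide_le_iff[of "1 / (pi * \<rho>\<^sup>2)" "ennreal ((cmod (g z))\<^sup>2)" "\<integral>\<^sup>+w\<in>ball z \<rho>. ennreal ((cmod (g w))\<^sup>2) \<partial>lborel"]
      by (simp add: divide_ennreal ennreal_mult[symmetric])
    also have "\<dots> = (\<integral>\<^sup>+w\<in>ball z \<rho>. G w \<partial>lborel) * ennreal (1 / (pi * \<rho>\<^sup>2))"
    proof -
      have "ennreal ((cmod (g w))\<^sup>2) * indicator (ball z \<rho>) w = G w * indicator (ball z \<rho>) w" for w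
        using sub by (cases "w \<in> ball z \<rho>") (auto simp: G_def indicator_def subset_iff)
      then show ?thesis by simp
    qed
    also have "\<dots> = (\<integral>\<^sup>+w. G w * indicator (ball z \<rho>) w * ennreal (1 / (pi * \<rho>\<^sup>2)) \<partial>lborel)"
      by (subst nn_integral_multc) auto
    also have "\<dots> = (\<integral>\<^sup>+w. k w z * G w \<partial>lborel)"
      using True by (intro nn_integral_cong)
        (auto simp: k_def \<rho>_def indicator_def dist_norm power_divide mult.commute)
    finally have "ennreal ((cmod (g z))\<^sup>2) \<le> (\<integral>\<^sup>+w. k w z * G w \<partial>lborel)" .
    moreover have "G z = ennreal ((cmod (g z))\<^sup>2)" using True by (simp add: G_def)
    ultimately have "count_density z * G z \<le> count_density z * (\<integral>\<^sup>+w. k w z * G w \<partial>lborel)"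
      by (intro mult_left_mono) auto
    also have "\<dots> = (\<integral>\<^sup>+w. count_density z * k w z * G w \<partial>lborel)"
      by (subst nn_integral_cmult[symmetric]) (auto simp: mult.assoc)
    finally show ?thesis by (simp add: mult.commute)
  qed (simp add: G_def)
  \<comment> \<open>This set contains every \<open>z\<close> whose averaging disc contains
    \<open>w\<close>: from \<open>cmod (z - w) < (1 - cmod z) / 2\<close> and the triangle
    inequality, \<open>cmod (z - w) < 1 - cmod w\<close>.\<close>
  define A where "A = (\<lambda>w. {z \<in> ball 0 1. cmod (z - w) < 1 - cmod w})"
  have [measurable]: "{z \<in> ball 0 1. cmod (z - w) < d} \<in> sets borel" for w and d
  proof -
    have "{z \<in> ball 0 1. cmod (z - w) < d} = ball 0 1 \<inter> ball w d"
      by (auto simp: dist_norm norm_minus_commute)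
    then show ?thesis by simp
  qed
  then have [measurable]: "A w \<in> sets borel" for w by (simp add: A_def)
  \<comment> \<open>The constant 9 comes from \<open>1 - cmod w \<le> 3/2 * (1 - cmod z)\<close>,
    squared and combined with the 4 in \<open>k\<close>.\<close>
  have kA: "k w z \<le> ennreal (9 / (pi * (1 - cmod w)\<^sup>2)) * indicator (A w) z" if w: "cmod w < 1" for w z
  proof (cases "cmod z < 1 \<and> cmod (z - w) < (1 - cmod z) / 2")
    case True
    have tr: "cmod w \<le> cmod z + cmod (z - w)" "cmod z \<le> cmod w + cmod (z - w)"
      by (metis add.commute norm_minus_commute norm_triangle_sub)+
    then have "z \<in> A w" using True by (auto simp: A_def field_simps)
    moreover have "4 / (pi * (1 - cmod z)\<^sup>2) \<le> 9 / (pi * (1 - cmod w)\<^sup>2)"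
    proof -
      have "2 * (1 - cmod w) \<le> 3 * (1 - cmod z)" using tr True by (simp add: field_simps)
      then have "(2 * (1 - cmod w))\<^sup>2 \<le> (3 * (1 - cmod z))\<^sup>2" using w by (intro power_mono) auto
      then have "4 * (1 - cmod w)\<^sup>2 \<le> 9 * (1 - cmod z)\<^sup>2" by (simp only: power_mult_distrib) simp
      then show ?thesis using w True by (simp add: divide_simps)
    qed
    ultimately show ?thesis using True by (simp add: k_def ennreal_leI)
  qed (auto simp: k_def)
  have K: "(\<integral>\<^sup>+z. count_density z * k w z \<partial>lborel) \<le> ennreal (9 / (pi * (1 - cmod w)\<^sup>2)) * (\<integral>\<^sup>+z\<in>A w. count_density z \<partial>lborel)"
    if w: "cmod w < 1" for w
  proof -
    have "(\<integral>\<^sup>+z. count_density z * k w z \<partial>lborel) \<le> (\<integral>\<^sup>+z. ennreal (9 / (pi * (1 - cmod w)\<^sup>2)) * (count_density z * indicator (A w) z) \<partial>lborel)"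
    proof (rule nn_integral_mono)
      fix z
      have "count_density z * k w z \<le> count_density z * (ennreal (9 / (pi * (1 - cmod w)\<^sup>2)) * indicator (A w) z)"
        by (intro mult_left_mono kA w) auto
      then show "count_density z * k w z \<le> ennreal (9 / (pi * (1 - cmod w)\<^sup>2)) * (count_density z * indicator (A w) z)"
        by (simp add: mult_ac)
    qed
    also have "\<dots> = ennreal (9 / (pi * (1 - cmod w)\<^sup>2)) * (\<integral>\<^sup>+z\<in>A w. count_density z \<partial>lborel)"
      by (rule nn_integral_cmult) measurable
    finally show ?thesis .
  qed
  have K1: "(\<integral>\<^sup>+z. count_density z * k w z \<partial>lborel) \<le> ennreal (9 / (pi * (1 - r)\<^sup>2)) * total_mass" if w: "cmod w \<le> r" for w
  proof -
    have "(\<integral>\<^sup>+z\<in>A w. count_density z \<partial>lborel) \<le> total_mass"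
      unfolding total_mass_def by (intro nn_integral_mono) (auto simp: A_def indicator_def)
    moreover have "9 / (pi * (1 - cmod w)\<^sup>2) \<le> 9 / (pi * (1 - r)\<^sup>2)"
      using w r by (intro divide_left_mono mult_left_mono power_mono mult_pos_pos) auto
    ultimately have "ennreal (9 / (pi * (1 - cmod w)\<^sup>2)) * (\<integral>\<^sup>+z\<in>A w. count_density z \<partial>lborel) \<le> ennreal (9 / (pi * (1 - r)\<^sup>2)) * total_mass"
      by (intro mult_mono ennreal_leI) auto
    then show ?thesis using K[of w] w r by auto
  qed
  \<comment> \<open>Near the circle, \<open>A w\<close> lies in the Carleson region about the radial
    projection of \<open>w\<close> with \<delta> twice the distance of \<open>w\<close> to the
    circle. Then \<open>\<delta>^2\<close> supplies a factor 4, and doubling from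
    \<open>1 - \<delta>\<close> to \<open>cmod w\<close>, with ratio 2, supplies
    \<open>4 ^ q\<close>; with the 9 above this gives \<open>36 * 4 ^ q\<close>. The assumption
    \<open>1/2 \<le> r\<close> keeps \<delta> below 1.\<close>
  have K2: "(\<integral>\<^sup>+z. count_density z * k w z \<partial>lborel) \<le> ennreal (36 * 4 ^ q * Q) * disc_weight w" if w: "r < cmod w" "cmod w < 1" for w
  proof -
    define \<zeta> where "\<zeta> = w / cmod w"
    define \<delta> where "\<delta> = 2 * (1 - cmod w)"
    have w0: "cmod w > 0" using w r by linarith
    have \<zeta>: "cmod \<zeta> = 1" using w0 by (simp add: \<zeta>_def norm_divide)
    have w\<zeta>: "cmod (w - \<zeta>) = 1 - cmod w"
    proof -
      have "w - \<zeta> = - ((1 - cmod w) *\<^sub>R \<zeta>)" using w0 by (simp add: \<zeta>_def scaleR_conv_of_real field_simps)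
      then show ?thesis using \<zeta> w by simp
    qed
    have \<delta>: "0 < \<delta>" "\<delta> < 2 * (1 - r)" "\<delta> < 1" using w r by (auto simp: \<delta>_def)
    have "A w \<subseteq> {z \<in> ball 0 1. cmod (z - \<zeta>) < \<delta>}"
    proof
      fix z assume z: "z \<in> A w"
      have "cmod (z - \<zeta>) \<le> cmod (z - w) + cmod (w - \<zeta>)"
        by (metis norm_triangle_ineq diff_add_cancel add_diff_eq)
      then show "z \<in> {z \<in> ball 0 1. cmod (z - \<zeta>) < \<delta>}"
        using z w\<zeta> by (auto simp: A_def \<delta>_def)
    qed
    then have "(\<integral>\<^sup>+z\<in>A w. count_density z \<partial>lborel) \<le> (\<integral>\<^sup>+z\<in>{z \<in> ball 0 1. cmod (z - \<zeta>) < \<delta>}. count_density z \<partial>lborel)"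
      by (intro nn_integral_mono) (auto simp: indicator_def)
    also have "\<dots> \<le> ennreal Q * ennreal (\<delta>\<^sup>2 * \<omega> (1 - \<delta>)) * ennreal pi"
      using Q[OF \<delta>(1,2) \<zeta>] pos[of "1 - \<delta>"] \<delta> unfolding carleson_quot_eq
      by (simp add: ennreal_divide_le_iff)
    finally have I: "(\<integral>\<^sup>+z\<in>A w. count_density z \<partial>lborel) \<le> ennreal (Q * (\<delta>\<^sup>2 * \<omega> (1 - \<delta>)) * pi)"
      using \<open>0 \<le> Q\<close> pos[of "1 - \<delta>"] \<delta> by (simp add: ennreal_mult[symmetric])
    have "\<omega> (1 - \<delta>) \<le> \<omega> (cmod w) * (\<delta> / (1 - cmod w)) ^ (2 * q)"
      using doubling[of "1 - \<delta>" "cmod w"] \<delta> w by (simp add: \<delta>_def)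
    also have "\<delta> / (1 - cmod w) = 2" using w by (simp add: \<delta>_def field_simps)
    finally have dw: "\<omega> (1 - \<delta>) \<le> \<omega> (cmod w) * 4 ^ q" by (simp add: power_mult)
    have "9 / (pi * (1 - cmod w)\<^sup>2) * (Q * (\<delta>\<^sup>2 * \<omega> (1 - \<delta>)) * pi) = 36 * Q * \<omega> (1 - \<delta>)"
    proof -
      have "\<delta>\<^sup>2 = 4 * (1 - cmod w)\<^sup>2" by (simp add: \<delta>_def power2_eq_square algebra_simps)
      then show ?thesis using w by simp
    qed
    also have "\<dots> \<le> 36 * 4 ^ q * Q * \<omega> (cmod w)"
      using mult_left_mono[OF dw, of "36 * Q"] \<open>0 \<le> Q\<close> by (simp add: mult_ac)
    finally have fin: "9 / (pi * (1 - cmod w)\<^sup>2) * (Q * (\<delta>\<^sup>2 * \<omega> (1 - \<delta>)) * pi) \<le> 36 * 4 ^ q * Q * \<omega> (cmod w)" .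
    have "(\<integral>\<^sup>+z. count_density z * k w z \<partial>lborel) \<le> ennreal (9 / (pi * (1 - cmod w)\<^sup>2)) * ennreal (Q * (\<delta>\<^sup>2 * \<omega> (1 - \<delta>)) * pi)"
      using K[OF w(2)] I by (meson mult_left_mono order_trans zero_le)
    also have "\<dots> = ennreal (9 / (pi * (1 - cmod w)\<^sup>2) * (Q * (\<delta>\<^sup>2 * \<omega> (1 - \<delta>)) * pi))"
      using \<open>0 \<le> Q\<close> pos[of "1 - \<delta>"] \<delta> by (intro ennreal_mult[symmetric]) auto
    also have "\<dots> \<le> ennreal (36 * 4 ^ q * Q * \<omega> (cmod w))"
      by (rule ennreal_leI[OF fin])
    also have "\<dots> = ennreal (36 * 4 ^ q * Q) * disc_weight w"
      using w \<open>0 \<le> Q\<close> pos[of "cmod w"] by (simp add: disc_weight_def ennreal_mult)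
    finally show ?thesis .
  qed
  have "(\<integral>\<^sup>+z. G z * count_density z \<partial>lborel) \<le> (\<integral>\<^sup>+z. (\<integral>\<^sup>+w. count_density z * k w z * G w \<partial>lborel) \<partial>lborel)"
    by (intro nn_integral_mono mean)
  also have "\<dots> = (\<integral>\<^sup>+w. (\<integral>\<^sup>+z. count_density z * k w z * G w \<partial>lborel) \<partial>lborel)"
    by (rule lborel_pair.Fubini') measurable
  also have "\<dots> = (\<integral>\<^sup>+w. G w * (\<integral>\<^sup>+z. count_density z * k w z \<partial>lborel) \<partial>lborel)"
    by (subst nn_integral_multc) (auto simp: mult.commute)
  also have "\<dots> \<le> (\<integral>\<^sup>+w. ennreal (36 * 4 ^ q * Q) * (G w * disc_weight w)
      + ennreal (9 / (pi * (1 - r)\<^sup>2)) * total_mass * (G w * indicator (cball 0 r) w) \<partial>lborel)"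
  proof (rule nn_integral_mono)
    fix w
    consider "cmod w \<ge> 1" | "cmod w \<le> r" | "r < cmod w" "cmod w < 1" by linarith
    then show "G w * (\<integral>\<^sup>+z. count_density z * k w z \<partial>lborel) \<le> ennreal (36 * 4 ^ q * Q) * (G w * disc_weight w)
      + ennreal (9 / (pi * (1 - r)\<^sup>2)) * total_mass * (G w * indicator (cball 0 r) w)"
    proof cases
      case 2
      then have "G w * (\<integral>\<^sup>+z. count_density z * k w z \<partial>lborel) \<le> G w * (ennreal (9 / (pi * (1 - r)\<^sup>2)) * total_mass)"
        by (intro mult_left_mono K1) auto
      then show ?thesis using 2 by (simp add: mult_ac add_increasing)
    next
      case 3
      then have "G w * (\<integral>\<^sup>+z. count_density z * k w z \<partial>lborel) \<le> G w * (ennreal (36 * 4 ^ q * Q) * disc_weight w)"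
        by (intro mult_left_mono K2) auto
      then show ?thesis by (simp add: mult_ac add_increasing2)
    qed (simp add: G_def)
  qed
  also have "\<dots> = ennreal (36 * 4 ^ q * Q) * (\<integral>\<^sup>+w. G w * disc_weight w \<partial>lborel)
    + ennreal (9 / (pi * (1 - r)\<^sup>2)) * total_mass * (\<integral>\<^sup>+w\<in>cball 0 r. G w \<partial>lborel)"
    by (simp add: nn_integral_add nn_integral_cmult)
  finally show ?thesis .
qed

end

section \<open>Test functions\<close>

lemma one_minus_cnj_mult_lower:
  assumes "cmod a < 1" "cmod z < 1"
  shows "1 - cmod a \<le> cmod (1 - cnj a * z)" "1 - cmod z \<le> cmod (1 - cnj a * z)" "1 - cnj a * z \<noteq> 0"
proof -
  have "1 - cmod a * cmod z \<le> cmod (1 - cnj a * z)"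
    using norm_triangle_ineq2[of 1 "cnj a * z"] by (simp add: norm_mult)
  moreover have "cmod a * cmod z \<le> cmod a" "cmod a * cmod z \<le> cmod z"
    using assms by (simp_all add: mult_left_le mult_left_le_one_le)
  ultimately show "1 - cmod a \<le> cmod (1 - cnj a * z)" "1 - cmod z \<le> cmod (1 - cnj a * z)" by linarith+
  then show "1 - cnj a * z \<noteq> 0" using assms by auto
qed

text \<open>The integrand is, up to the factor \<open>(1 - |a|\<^sup>2)\<^sup>2\<close>, the Jacobian of a disc automorphism.\<close>

lemma nn_integral_inverse_fourth_power_le:
  assumes a: "cmod a < 1"
  shows "(\<integral>\<^sup>+z\<in>ball 0 1. ennreal (1 / cmod (1 - cnj a * z) ^ 4) \<partial>lborel) \<le> ennreal (pi / (1 - cmod a)\<^sup>2)"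
proof -
  let ?m = "Moebius_function 0 a"
  have hol: "?m holomorphic_on ball 0 1"
    by (rule Moebius_function_holomorphic[OF a])
  have inj: "inj_on ?m (ball 0 1)"
    by (rule inj_on_inverseI[of _ "Moebius_function 0 (-a)"])
       (use Moebius_function_compose[of "-a" a] a in auto)
  have sub: "?m ` ball 0 1 \<subseteq> ball 0 1"
    using Moebius_function_norm_lt_1[OF a] by auto
  have m: "?m ` ball 0 1 \<in> sets borel"
    using borel_image_holomorphic[OF open_ball hol inj] by simp
  have der: "deriv ?m z = of_real (1 - (cmod a)\<^sup>2) / (1 - cnj a * z)\<^sup>2" if "z \<in> ball 0 1" for z
  proof (rule DERIV_imp_deriv)
    have "1 - cnj a * z \<noteq> 0" using one_minus_cnj_mult_lower[OF a, of z] that by simp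
    then have "((\<lambda>z. (z - a) / (1 - cnj a * z)) has_field_derivative
        (1 * (1 - cnj a * z) - (z - a) * (- cnj a)) / ((1 - cnj a * z) * (1 - cnj a * z))) (at z)"
      by (auto intro!: derivative_eq_intros)
    moreover have "1 * (1 - cnj a * z) - (z - a) * (- cnj a) = of_real (1 - (cmod a)\<^sup>2)"
    proof -
      have "1 * (1 - cnj a * z) - (z - a) * (- cnj a) = 1 - a * cnj a" by (simp add: algebra_simps)
      then show ?thesis by (simp only: complex_norm_square[symmetric] of_real_diff of_real_1)
    qed
    moreover have "(\<lambda>z. (z - a) / (1 - cnj a * z)) = ?m" by (simp add: Moebius_function_simple[abs_def])
    ultimately show "(?m has_field_derivative of_real (1 - (cmod a)\<^sup>2) / (1 - cnj a * z)\<^sup>2) (at z)"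
      by (simp only: power2_eq_square)
  qed
  have "(\<integral>\<^sup>+z\<in>ball 0 1. ennreal ((cmod (deriv ?m z))\<^sup>2) \<partial>lborel) = emeasure lborel (?m ` ball 0 1)"
    using bounded_subset[OF bounded_ball sub]
    by (intro emeasure_holomorphic_image[OF open_ball hol inj, symmetric]) auto
  also have "\<dots> \<le> emeasure lborel (ball (0::complex) 1)"
    by (rule emeasure_mono[OF sub]) simp
  also have "\<dots> = ennreal pi" by (simp add: emeasure_ball unit_ball_vol_2)
  finally have le: "(\<integral>\<^sup>+z\<in>ball 0 1. ennreal ((cmod (deriv ?m z))\<^sup>2) \<partial>lborel) \<le> ennreal pi" .
  have "(\<integral>\<^sup>+z\<in>ball 0 1. ennreal (1 / cmod (1 - cnj a * z) ^ 4) \<partial>lborel)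
     \<le> (\<integral>\<^sup>+z. ennreal (1 / (1 - cmod a)\<^sup>2) * (ennreal ((cmod (deriv ?m z))\<^sup>2) * indicator (ball 0 1) z) \<partial>lborel)"
  proof (rule nn_integral_mono)
    fix z
    show "ennreal (1 / cmod (1 - cnj a * z) ^ 4) * indicator (ball 0 1) z \<le>
       ennreal (1 / (1 - cmod a)\<^sup>2) * (ennreal ((cmod (deriv ?m z))\<^sup>2) * indicator (ball 0 1) z)"
    proof (cases "z \<in> ball 0 1")
      case True
      have nz: "cmod (1 - cnj a * z) > 0" using one_minus_cnj_mult_lower[OF a, of z] True by simp
      have c: "cmod (of_real (1 - (cmod a)\<^sup>2)) = 1 - (cmod a)\<^sup>2"
        unfolding norm_of_real using a by (simp add: power_le_one)
      \<comment> \<open>This trades the exact Jacobian factor for \<open>1 - cmod a\<close>, which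
        equals \<delta> for the test functions.\<close>
      have "1 - cmod a \<le> 1 - (cmod a)\<^sup>2"
        using a by (simp add: power2_eq_square mult_left_le)
      then have "1 * (1 - cmod a)\<^sup>2 \<le> (1 - (cmod a)\<^sup>2)\<^sup>2"
        using a by (simp add: power_mono)
      then have "1 / cmod (1 - cnj a * z) ^ 4 \<le> 1 / (1 - cmod a)\<^sup>2 * (cmod (deriv ?m z))\<^sup>2"
        using a nz unfolding der[OF True] norm_divide norm_power c power_divide
        by (simp add: divide_simps)
      then show ?thesis using True by (simp add: ennreal_mult[symmetric] ennreal_leI)
    qed simp
  qed
  also have "\<dots> = ennreal (1 / (1 - cmod a)\<^sup>2) * (\<integral>\<^sup>+z\<in>ball 0 1. ennreal ((cmod (deriv ?m z))\<^sup>2) \<partial>lborel)"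
  proof (rule nn_integral_cmult)
    have "(\<lambda>z. ennreal (indicator (ball 0 1) z * (cmod (deriv ?m z))\<^sup>2)) \<in> borel_measurable borel"
      by (intro borel_measurable_holomorphic_cmod_square holomorphic_deriv hol) auto
    also have "(\<lambda>z. ennreal (indicator (ball 0 1) z * (cmod (deriv ?m z))\<^sup>2)) = (\<lambda>z. ennreal ((cmod (deriv ?m z))\<^sup>2) * indicator (ball 0 1) z)"
      by (auto simp: indicator_def)
    finally show "(\<lambda>z. ennreal ((cmod (deriv ?m z))\<^sup>2) * indicator (ball 0 1) z) \<in> borel_measurable lborel" by simp
  qed
  also have "\<dots> \<le> ennreal (1 / (1 - cmod a)\<^sup>2) * ennreal pi"
    by (intro mult_left_mono le) auto
  also have "\<dots> = ennreal (pi / (1 - cmod a)\<^sup>2)"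
    by (simp add: ennreal_mult[symmetric])
  finally show ?thesis .
qed

lemma power_add_2_square: "(x ^ (q + 2))\<^sup>2 = x ^ (2 * q + 4)" for x :: "'a::monoid_mult"
proof -
  have "(x ^ (q + 2))\<^sup>2 = x ^ (2 * (q + 2))" by (rule power_even_eq[symmetric])
  also have "2 * (q + 2) = 2 * q + 4" by simp
  finally show ?thesis .
qed

lemma norm_of_real_divide_power: "0 < c \<Longrightarrow> cmod (of_real c / x ^ n) = c / cmod x ^ n"
  by (simp add: norm_divide norm_power)

context doubling_weight
begin

text \<open>In the Dirichlet integral the weight contributes at most
  \<open>\<omega> (1 - \<delta>) * \<delta> powr (-2 * q)\<close> and the four remaining kernel
  powers integrate to at most \<open>pi / \<delta>^2\<close>. The square of this coefficient cancels
  both, leaving \<open>pi\<close>.\<close>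

definition test_coeff :: "real \<Rightarrow> real" where
  "test_coeff \<delta> = \<delta> ^ (q + 1) / sqrt (\<omega> (1 - \<delta>))"

text \<open>The primitive, vanishing at 0, of a multiple of the power \<open>-(q + 2)\<close> of \<open>1 - cnj a * z\<close>, where
  \<open>a = (1 - \<delta>) * \<zeta>\<close>. The multiple normalises the Dirichlet integral.\<close>

definition test_fun :: "real \<Rightarrow> complex \<Rightarrow> complex \<Rightarrow> complex" where
  "test_fun \<delta> \<zeta> z = of_real (test_coeff \<delta>) *
     ((inverse ((1 - cnj (of_real (1 - \<delta>) * \<zeta>) * z) ^ (q + 1)) - 1) / (of_nat (q + 1) * cnj (of_real (1 - \<delta>) * \<zeta>)))"

context
  fixes \<delta> :: real and \<zeta> a :: complex
  assumes \<delta>: "0 < \<delta>" "\<delta> < 1" and \<zeta>: "cmod \<zeta> = 1"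
  defines "a \<equiv> of_real (1 - \<delta>) * \<zeta>"
begin

lemma cmod_a: "cmod a = 1 - \<delta>" "cmod a < 1" "a \<noteq> 0"
proof -
  show "cmod a = 1 - \<delta>" unfolding a_def norm_mult norm_of_real using \<delta> \<zeta> by simp
  then show "cmod a < 1" "a \<noteq> 0" using \<delta> by auto
qed

lemma test_coeff_pos: "0 < test_coeff \<delta>"
  using \<delta> pos[of "1 - \<delta>"] by (simp add: test_coeff_def)

lemma has_field_derivative_test_fun:
  assumes "z \<in> ball 0 1"
  shows "(test_fun \<delta> \<zeta> has_field_derivative of_real (test_coeff \<delta>) / (1 - cnj a * z) ^ (q + 2)) (at z)"
proof -
  have nz: "1 - cnj a * z \<noteq> 0" using one_minus_cnj_mult_lower[OF cmod_a(2), of z] assms by simp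
  have "((\<lambda>z. 1 - cnj a * z) has_field_derivative - cnj a) (at z)"
    by (auto intro!: derivative_eq_intros)
  from DERIV_power[OF this, of "q + 1"]
  have "((\<lambda>z. (1 - cnj a * z) ^ (q + 1)) has_field_derivative of_nat (q + 1) * (1 - cnj a * z) ^ q * (- cnj a)) (at z)"
    by (simp add: mult_ac)
  note DERIV_inverse_fun[OF this power_not_zero[OF nz]]
  moreover have "- (of_nat (q + 1) * (1 - cnj a * z) ^ q * (- cnj a) * inverse (((1 - cnj a * z) ^ (q + 1)) ^ Suc (Suc 0)))
     = of_nat (q + 1) * cnj a / (1 - cnj a * z) ^ (q + 2)"
  proof -
    have e: "(y ^ (q + 1)) ^ Suc (Suc 0) = y ^ q * y ^ (q + 2)" for y :: complex
      by (simp add: mult_ac)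
    have f: "- (n * P * (- c) * inverse (P * R)) = n * c / R" if "P \<noteq> 0" "R \<noteq> 0" for n c P R :: complex
      using that by (simp add: field_simps)
    show ?thesis unfolding e by (rule f[OF power_not_zero[OF nz] power_not_zero[OF nz]])
  qed
  ultimately have "((\<lambda>z. inverse ((1 - cnj a * z) ^ (q + 1))) has_field_derivative of_nat (q + 1) * cnj a / (1 - cnj a * z) ^ (q + 2)) (at z)"
    by simp
  then have "((\<lambda>z. of_real (test_coeff \<delta>) * ((inverse ((1 - cnj a * z) ^ (q + 1)) - 1) / (of_nat (q + 1) * cnj a)))
     has_field_derivative of_real (test_coeff \<delta>) * ((of_nat (q + 1) * cnj a / (1 - cnj a * z) ^ (q + 2) - 0) / (of_nat (q + 1) * cnj a))) (at z)"
    by (intro DERIV_cmult DERIV_cdivide DERIV_diff DERIV_const)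
  moreover have "of_nat (q + 1) * cnj a \<noteq> 0" using cmod_a(3) by (simp del: of_nat_Suc of_nat_add)
  ultimately show ?thesis
    unfolding test_fun_def[abs_def] a_def by (simp del: of_nat_Suc of_nat_add complex_cnj_mult)
qed

lemma holomorphic_test_fun: "test_fun \<delta> \<zeta> holomorphic_on ball 0 1"
  using has_field_derivative_test_fun by (metis holomorphic_on_open open_ball)

lemma deriv_test_fun:
  "z \<in> ball 0 1 \<Longrightarrow> deriv (test_fun \<delta> \<zeta>) z = of_real (test_coeff \<delta>) / (1 - cnj a * z) ^ (q + 2)"
  using has_field_derivative_test_fun DERIV_imp_deriv by blast

lemma test_fun_0: "test_fun \<delta> \<zeta> 0 = 0"
  by (simp add: test_fun_def)

lemma test_coeff_square: "(test_coeff \<delta>)\<^sup>2 = \<delta> ^ (2 * q + 2) / \<omega> (1 - \<delta>)"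
proof -
  have "(\<delta> ^ (q + 1))\<^sup>2 = \<delta> ^ (2 * (q + 1))" by (rule power_even_eq[symmetric])
  also have "2 * (q + 1) = 2 * q + 2" by simp
  finally show ?thesis using \<delta> pos[of "1 - \<delta>"] by (simp only: test_coeff_def power_divide) simp
qed

text \<open>The kernel dominates both distances, \<open>1 - cmod z\<close> and \<delta>. For
  \<open>z\<close> closer to the centre than \<open>a\<close> the doubling condition applies with
  the first; otherwise the weight is at most \<open>\<omega> (1 - \<delta>)\<close> and the second
  makes the factor at least 1.\<close>

lemma weight_le_kernel:
  assumes z: "z \<in> ball 0 1"
  shows "\<omega> (cmod z) \<le> \<omega> (1 - \<delta>) * (cmod (1 - cnj a * z) / \<delta>) ^ (2 * q)"
proof -
  have lo: "\<delta> \<le> cmod (1 - cnj a * z)" "1 - cmod z \<le> cmod (1 - cnj a * z)"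
    using one_minus_cnj_mult_lower[OF cmod_a(2), of z] z cmod_a(1) by auto
  have w: "0 < \<omega> (1 - \<delta>)" using pos \<delta> by simp
  show ?thesis
  proof (cases "cmod z \<le> 1 - \<delta>")
    case True
    have "\<omega> (cmod z) \<le> \<omega> (1 - \<delta>) * ((1 - cmod z) / \<delta>) ^ (2 * q)"
      using doubling[of "cmod z" "1 - \<delta>"] True \<delta> by simp
    also have "\<dots> \<le> \<omega> (1 - \<delta>) * (cmod (1 - cnj a * z) / \<delta>) ^ (2 * q)"
      using w z \<delta> lo by (intro mult_left_mono power_mono divide_right_mono) auto
    finally show ?thesis .
  next
    case False
    have "\<omega> (cmod z) \<le> \<omega> (1 - \<delta>) * 1"
      using antimono[of "1 - \<delta>" "cmod z"] False \<delta> z by simp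
    also have "\<dots> \<le> \<omega> (1 - \<delta>) * (cmod (1 - cnj a * z) / \<delta>) ^ (2 * q)"
      using w \<delta> lo by (intro mult_left_mono one_le_power) auto
    finally show ?thesis .
  qed
qed

text \<open>Of the \<open>2 * q + 4\<close> kernel powers in the squared derivative,
  \<open>2 * q\<close> absorb the weight; what remains is the integral bounded by the area of the
  image of a disc automorphism.\<close>

lemma Dint_test_fun_le_1: "Dint \<omega> (test_fun \<delta> \<zeta>) \<le> 1"
proof -
  have "(\<integral>\<^sup>+z\<in>ball 0 1. ennreal ((cmod (deriv (test_fun \<delta> \<zeta>) z))\<^sup>2) * disc_weight z \<partial>lborel)
     \<le> (\<integral>\<^sup>+z. ennreal (\<delta>\<^sup>2) * (ennreal (1 / cmod (1 - cnj a * z) ^ 4) * indicator (ball 0 1) z) \<partial>lborel)"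
  proof (rule nn_integral_mono)
    fix z
    show "ennreal ((cmod (deriv (test_fun \<delta> \<zeta>) z))\<^sup>2) * disc_weight z * indicator (ball 0 1) z \<le>
      ennreal (\<delta>\<^sup>2) * (ennreal (1 / cmod (1 - cnj a * z) ^ 4) * indicator (ball 0 1) z)"
    proof (cases "z \<in> ball 0 1")
      case True
      define t where "t = cmod (1 - cnj a * z)"
      have t: "t > 0" using one_minus_cnj_mult_lower[OF cmod_a(2), of z] True by (simp add: t_def)
      have w: "0 < \<omega> (1 - \<delta>)" using pos \<delta> by simp
      have eq: "(cmod (deriv (test_fun \<delta> \<zeta>) z))\<^sup>2 = \<delta> ^ (2 * q + 2) / \<omega> (1 - \<delta>) / t ^ (2 * q + 4)"
        unfolding deriv_test_fun[OF True] norm_of_real_divide_power[OF test_coeff_pos] power_divide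
          power_add_2_square test_coeff_square t_def ..
      have "(cmod (deriv (test_fun \<delta> \<zeta>) z))\<^sup>2 * \<omega> (cmod z)
         \<le> \<delta> ^ (2 * q + 2) / \<omega> (1 - \<delta>) / t ^ (2 * q + 4) * (\<omega> (1 - \<delta>) * (t / \<delta>) ^ (2 * q))"
        unfolding eq using \<delta> w t weight_le_kernel[OF True, folded t_def] by (intro mult_left_mono) auto
      also have "\<dots> = \<delta>\<^sup>2 * (1 / t ^ 4)"
      proof -
        have "\<delta> ^ (2 * q + 2) = \<delta> ^ (2 * q) * \<delta>\<^sup>2" "t ^ (2 * q + 4) = t ^ (2 * q) * t ^ 4"
          by (rule power_add)+
        then show ?thesis unfolding power_divide using \<delta> w t by simp
      qed
      finally have "(cmod (deriv (test_fun \<delta> \<zeta>) z))\<^sup>2 * \<omega> (cmod z) \<le> \<delta>\<^sup>2 * (1 / t ^ 4)" .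
      then have "ennreal ((cmod (deriv (test_fun \<delta> \<zeta>) z))\<^sup>2 * \<omega> (cmod z)) \<le> ennreal (\<delta>\<^sup>2 * (1 / t ^ 4))"
        by (rule ennreal_leI)
      then show ?thesis
        using True t pos[of "cmod z"] unfolding t_def[symmetric]
        by (simp add: disc_weight_def ennreal_mult[symmetric])
    qed simp
  qed
  also have "\<dots> = ennreal (\<delta>\<^sup>2) * (\<integral>\<^sup>+z\<in>ball 0 1. ennreal (1 / cmod (1 - cnj a * z) ^ 4) \<partial>lborel)"
  proof (rule nn_integral_cmult)
    have [measurable]: "ball (0::complex) 1 \<in> sets borel" by simp
    show "(\<lambda>z. ennreal (1 / cmod (1 - cnj a * z) ^ 4) * indicator (ball 0 1) z) \<in> borel_measurable lborel"
      by measurable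
  qed
  also have "\<dots> \<le> ennreal (\<delta>\<^sup>2) * ennreal (pi / (1 - cmod a)\<^sup>2)"
    by (intro mult_left_mono nn_integral_inverse_fourth_power_le cmod_a) auto
  also have "\<dots> = ennreal pi"
    using \<delta> by (simp add: cmod_a ennreal_mult[symmetric])
  finally show ?thesis
    unfolding Dint_eq by (subst ennreal_divide_le_iff) auto
qed

lemma test_fun_in_Hw: "test_fun \<delta> \<zeta> \<in> Hw \<omega>"
  using holomorphic_test_fun Dint_test_fun_le_1 by (auto simp: Hw_def intro: le_less_trans)

lemma Hnorm_test_fun_le_1: "Hnorm \<omega> (test_fun \<delta> \<zeta>) \<le> 1"
proof -
  have "enn2real (Dint \<omega> (test_fun \<delta> \<zeta>)) \<le> 1"
    using Dint_test_fun_le_1 by (intro enn2real_leI) auto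
  then show ?thesis by (simp add: Hnorm_def test_fun_0)
qed

text \<open>Doubling between 0 and \<open>1 - \<delta>\<close> gives \<open>\<omega> 0 * \<delta> ^
  (2 * q) \<le> \<omega> (1 - \<delta>)\<close>, so the coefficient is at most a multiple of
  \<delta>. The spare power of \<delta> makes the derivatives vanish pointwise as \<delta> tends to
  0, uniformly in \<zeta>.\<close>

lemma cmod_deriv_test_fun_le:
  assumes z: "z \<in> ball 0 1"
  shows "cmod (deriv (test_fun \<delta> \<zeta>) z) \<le> \<delta> / (sqrt (\<omega> 0) * (1 - cmod z) ^ (q + 2))"
proof -
  have "\<omega> 0 \<le> \<omega> (1 - \<delta>) * (1 / \<delta>) ^ (2 * q)"
    using doubling[of 0 "1 - \<delta>"] \<delta> by simp
  then have "\<omega> 0 * \<delta> ^ (2 * q) \<le> \<omega> (1 - \<delta>)" using \<delta> by (simp add: power_divide field_simps)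
  then have "sqrt (\<omega> 0 * (\<delta> ^ q)\<^sup>2) \<le> sqrt (\<omega> (1 - \<delta>))"
    by (simp add: power_mult[symmetric] mult.commute)
  then have 1: "sqrt (\<omega> 0) * \<delta> ^ q \<le> sqrt (\<omega> (1 - \<delta>))" using \<delta> by (simp add: real_sqrt_mult)
  have w: "0 < sqrt (\<omega> 0)" "0 < sqrt (\<omega> (1 - \<delta>))" using pos \<delta> by auto
  have c: "test_coeff \<delta> \<le> \<delta> / sqrt (\<omega> 0)"
  proof -
    have "test_coeff \<delta> \<le> \<delta> ^ (q + 1) / (sqrt (\<omega> 0) * \<delta> ^ q)"
      unfolding test_coeff_def using 1 w \<delta> by (intro divide_left_mono) auto
    then show ?thesis using \<delta> by simp
  qed
  have lo: "(1 - cmod z) ^ (q + 2) \<le> cmod (1 - cnj a * z) ^ (q + 2)"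
    using one_minus_cnj_mult_lower[OF cmod_a(2), of z] z by (intro power_mono) auto
  have "cmod (deriv (test_fun \<delta> \<zeta>) z) = test_coeff \<delta> / cmod (1 - cnj a * z) ^ (q + 2)"
    unfolding deriv_test_fun[OF z] by (rule norm_of_real_divide_power[OF test_coeff_pos])
  also have "\<dots> \<le> (\<delta> / sqrt (\<omega> 0)) / (1 - cmod z) ^ (q + 2)"
    using c lo test_coeff_pos w \<delta> z by (intro frac_le zero_less_power) auto
  finally show ?thesis by simp
qed

end

end

context composition_symbol
begin

text \<open>On the Carleson region the kernel is at most \<open>2 * \<delta>\<close>, so the squared
  derivative is at least \<open>1 / (4 ^ (q + 2) * \<delta>^2 * \<omega> (1 - \<delta>))\<close>
  there. Integrating against the counting density gives the claim.\<close>

lemma carleson_quot_le_Dint_test_fun: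
  assumes \<delta>: "0 < \<delta>" "\<delta> < 1" and \<zeta>: "cmod \<zeta> = 1"
  shows "carleson_quot \<omega> \<phi> \<delta> \<zeta> \<le> ennreal (4 ^ (q + 2)) * Dint \<omega> (test_fun \<delta> \<zeta> \<circ> \<phi>)"
proof -
  define a where "a = of_real (1 - \<delta>) * \<zeta>"
  let ?S = "{z \<in> ball 0 1. cmod (z - \<zeta>) < \<delta>}"
  define G where "G w = ennreal (indicator (ball 0 1) w * (cmod (deriv (test_fun \<delta> \<zeta>) w))\<^sup>2)" for w
  have [measurable]: "G \<in> borel_measurable borel"
    unfolding G_def
    by (intro borel_measurable_holomorphic_cmod_square holomorphic_deriv holomorphic_test_fun[OF assms]) auto
  have w: "0 < \<omega> (1 - \<delta>)" using pos \<delta> by simp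
  have cc: "0 < test_coeff \<delta>" by (rule test_coeff_pos[OF assms])
  have lower: "indicator ?S z \<le> ennreal (4 ^ (q + 2) * (\<delta>\<^sup>2 * \<omega> (1 - \<delta>))) * G z" for z
  proof (cases "z \<in> ?S")
    case True
    then have z: "z \<in> ball 0 1" by simp
    define t where "t = cmod (1 - cnj a * z)"
    have "t \<le> 2 * \<delta>"
    proof -
      have "cnj \<zeta> * \<zeta> = 1" using \<zeta> by (metis complex_norm_square mult.commute of_real_1 power_one)
      \<comment> \<open>Since |\<zeta>| = 1, moving from \<open>a\<close> to \<zeta> splits the
        kernel into two terms, each of modulus at most \<delta>.\<close>
      then have "1 - cnj a * z = cnj \<zeta> * (\<zeta> - z) + of_real \<delta> * cnj \<zeta> * z"
        by (simp add: a_def algebra_simps)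
      then have "t \<le> cmod (cnj \<zeta> * (\<zeta> - z)) + cmod (of_real \<delta> * cnj \<zeta> * z)"
        unfolding t_def by (metis norm_triangle_ineq)
      also have "\<dots> = cmod (z - \<zeta>) + \<delta> * cmod z"
        using \<zeta> \<delta> by (simp add: norm_mult norm_minus_commute)
      also have "\<dots> \<le> \<delta> + \<delta> * 1"
        using True \<delta> by (intro add_mono mult_left_mono) auto
      finally show ?thesis by simp
    qed
    moreover have t: "t > 0"
      using one_minus_cnj_mult_lower[of a z] z \<delta> \<zeta> by (simp add: t_def a_def norm_mult del: of_real_diff)
    ultimately have tp: "t ^ (2 * q + 4) \<le> (2 * \<delta>) ^ (2 * q + 4)" by (intro power_mono) auto
    have "(cmod (deriv (test_fun \<delta> \<zeta>) z))\<^sup>2 = \<delta> ^ (2 * q + 2) / \<omega> (1 - \<delta>) / t ^ (2 * q + 4)"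
      unfolding deriv_test_fun[OF assms z] norm_of_real_divide_power[OF cc] power_divide
        power_add_2_square test_coeff_square[OF assms] t_def a_def ..
    also have "\<dots> \<ge> \<delta> ^ (2 * q + 2) / \<omega> (1 - \<delta>) / (2 * \<delta>) ^ (2 * q + 4)"
      using tp t w \<delta> by (intro divide_left_mono) auto
    finally have "4 ^ (q + 2) * (\<delta>\<^sup>2 * \<omega> (1 - \<delta>)) * (\<delta> ^ (2 * q + 2) / \<omega> (1 - \<delta>) / (2 * \<delta>) ^ (2 * q + 4))
       \<le> 4 ^ (q + 2) * (\<delta>\<^sup>2 * \<omega> (1 - \<delta>)) * (cmod (deriv (test_fun \<delta> \<zeta>) z))\<^sup>2"
      using w \<delta> by (intro mult_left_mono) auto
    moreover have "4 ^ (q + 2) * (\<delta>\<^sup>2 * \<omega> (1 - \<delta>)) * (\<delta> ^ (2 * q + 2) / \<omega> (1 - \<delta>) / (2 * \<delta>) ^ (2 * q + 4)) = 1"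
    proof -
      have "(2::real) ^ (2 * q + 4) = 4 ^ (q + 2)"
        by (simp only: power_add) (simp add: power_mult)
      moreover have "\<delta> ^ (2 * q + 4) = \<delta>\<^sup>2 * \<delta> ^ (2 * q + 2)"
      proof -
        have "\<delta>\<^sup>2 * \<delta> ^ (2 * q + 2) = \<delta> ^ (2 + (2 * q + 2))" by (rule power_add[symmetric])
        also have "2 + (2 * q + 2) = 2 * q + 4" by simp
        finally show ?thesis by simp
      qed
      ultimately have "(2 * \<delta>) ^ (2 * q + 4) = 4 ^ (q + 2) * (\<delta>\<^sup>2 * \<delta> ^ (2 * q + 2))"
        by (simp only: power_mult_distrib)
      then show ?thesis using w \<delta> by simp
    qed
    ultimately have "1 \<le> ennreal (4 ^ (q + 2) * (\<delta>\<^sup>2 * \<omega> (1 - \<delta>)) * (cmod (deriv (test_fun \<delta> \<zeta>) z))\<^sup>2)"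
      by (metis ennreal_1 ennreal_leI)
    then show ?thesis using True w by (simp add: G_def ennreal_mult)
  qed simp
  have "(\<integral>\<^sup>+z\<in>?S. count_density z \<partial>lborel) \<le> (\<integral>\<^sup>+z. ennreal (4 ^ (q + 2) * (\<delta>\<^sup>2 * \<omega> (1 - \<delta>))) * (G z * count_density z) \<partial>lborel)"
  proof (rule nn_integral_mono)
    fix z
    show "count_density z * indicator ?S z \<le> ennreal (4 ^ (q + 2) * (\<delta>\<^sup>2 * \<omega> (1 - \<delta>))) * (G z * count_density z)"
      using mult_left_mono[OF lower[of z], of "count_density z"] by (simp add: mult_ac)
  qed
  also have "\<dots> = ennreal (4 ^ (q + 2) * (\<delta>\<^sup>2 * \<omega> (1 - \<delta>))) * (\<integral>\<^sup>+z. G z * count_density z \<partial>lborel)"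
    by (rule nn_integral_cmult) measurable
  also have "(\<integral>\<^sup>+z. G z * count_density z \<partial>lborel) = Dint \<omega> (test_fun \<delta> \<zeta> \<circ> \<phi>) * ennreal pi"
    unfolding Dint_comp[OF holomorphic_test_fun[OF assms]] G_def
    by (simp add: ennreal_divide_times ennreal_divide_self)
  finally have "(\<integral>\<^sup>+z\<in>?S. count_density z \<partial>lborel) \<le> ennreal (4 ^ (q + 2) * (\<delta>\<^sup>2 * \<omega> (1 - \<delta>))) * (Dint \<omega> (test_fun \<delta> \<zeta> \<circ> \<phi>) * ennreal pi)" .
  also have "\<dots> = ennreal (4 ^ (q + 2)) * Dint \<omega> (test_fun \<delta> \<zeta> \<circ> \<phi>) * ennreal (\<delta>\<^sup>2 * \<omega> (1 - \<delta>)) * ennreal pi"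
    using w by (subst ennreal_mult) (auto simp: mult_ac)
  finally show ?thesis
    unfolding carleson_quot_eq using w \<delta>
    by (subst ennreal_divide_le_iff, simp, subst ennreal_divide_le_iff) auto
qed

end

section \<open>Norm estimates and Fatou's lemma\<close>

context doubling_weight
begin

lemma Hnorm_nonneg: "0 \<le> Hnorm \<omega> f"
  by (simp add: Hnorm_def)

lemma Hnorm_square: "(Hnorm \<omega> f)\<^sup>2 = (cmod (f 0))\<^sup>2 + enn2real (Dint \<omega> f)"
  by (simp add: Hnorm_def)

lemma cmod_0_le_Hnorm: "cmod (f 0) \<le> Hnorm \<omega> f"
  unfolding Hnorm_def by (rule real_le_rsqrt) simp

text \<open>Membership in the space matters: \<open>enn2real\<close> would turn an infinite
  Dirichlet integral into 0.\<close>

lemma Dint_le_Hnorm_square: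
  assumes "f \<in> Hw \<omega>"
  shows "Dint \<omega> f \<le> ennreal ((Hnorm \<omega> f)\<^sup>2)"
proof -
  have "Dint \<omega> f = ennreal (enn2real (Dint \<omega> f))" using assms by (simp add: Hw_def)
  also have "\<dots> \<le> ennreal ((Hnorm \<omega> f)\<^sup>2)" by (intro ennreal_leI) (simp add: Hnorm_square)
  finally show ?thesis .
qed

definition energy :: "(complex \<Rightarrow> complex) \<Rightarrow> complex \<Rightarrow> ennreal" where
  "energy f z = ennreal (indicator (ball 0 1) z * (cmod (deriv f z))\<^sup>2) * disc_weight z"

lemma borel_measurable_energy:
  assumes "f holomorphic_on ball 0 1"
  shows "energy f \<in> borel_measurable borel"
proof -
  have "(\<lambda>z. ennreal (indicator (ball 0 1) z * (cmod (deriv f z))\<^sup>2)) \<in> borel_measurable borel"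
    using assms by (intro borel_measurable_holomorphic_cmod_square holomorphic_deriv) auto
  then show ?thesis unfolding energy_def by measurable
qed

lemma nn_integral_energy: "integral\<^sup>N lborel (energy f) = Dint \<omega> f * ennreal pi"
proof -
  have "Dint \<omega> f * ennreal pi = (\<integral>\<^sup>+z\<in>ball 0 1. ennreal ((cmod (deriv f z))\<^sup>2) * disc_weight z \<partial>lborel)"
    by (simp add: Dint_eq ennreal_divide_times ennreal_divide_self)
  also have "\<dots> = integral\<^sup>N lborel (energy f)"
    by (intro nn_integral_cong) (auto simp: energy_def indicator_def)
  finally show ?thesis by simp
qed

lemma Dint_le_iff: "Dint \<omega> f \<le> c \<longleftrightarrow> integral\<^sup>N lborel (energy f) \<le> c * ennreal pi"
proof -
  have "Dint \<omega> f = integral\<^sup>N lborel (energy f) / ennreal pi"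
    by (simp add: nn_integral_energy ennreal_mult_divide_eq)
  then show ?thesis by (simp only: ennreal_divide_le_iff[OF pi_gt_zero])
qed

text \<open>A substitute for the triangle inequality, from
  \<open>(x + y)^2 \<le> 2 * x^2 + 2 * y^2\<close>. Assuming only a pointwise bound on derivatives
  covers sums and differences alike.\<close>

lemma Dint_le_2_add:
  assumes f: "f holomorphic_on ball 0 1" and g: "g holomorphic_on ball 0 1"
    and le: "\<And>z. z \<in> ball 0 1 \<Longrightarrow> cmod (deriv h z) \<le> cmod (deriv f z) + cmod (deriv g z)"
  shows "Dint \<omega> h \<le> 2 * Dint \<omega> f + 2 * Dint \<omega> g"
proof -
  have [measurable]: "energy f \<in> borel_measurable borel" "energy g \<in> borel_measurable borel"
    using f g borel_measurable_energy by blast+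
  have "energy h z \<le> 2 * energy f z + 2 * energy g z" for z
  proof (cases "z \<in> ball 0 1")
    case True
    have "(cmod (deriv h z))\<^sup>2 \<le> (cmod (deriv f z) + cmod (deriv g z))\<^sup>2"
      using le[OF True] by (intro power_mono) auto
    also have "\<dots> \<le> 2 * (cmod (deriv f z))\<^sup>2 + 2 * (cmod (deriv g z))\<^sup>2"
      using sum_squares_bound[of "cmod (deriv f z)" "cmod (deriv g z)"] by (simp add: power2_sum)
    finally have "ennreal ((cmod (deriv h z))\<^sup>2) \<le> ennreal (2 * (cmod (deriv f z))\<^sup>2 + 2 * (cmod (deriv g z))\<^sup>2)"
      by (rule ennreal_leI)
    also have "\<dots> = 2 * ennreal ((cmod (deriv f z))\<^sup>2) + 2 * ennreal ((cmod (deriv g z))\<^sup>2)"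
      by (simp add: ennreal_mult)
    finally have "ennreal ((cmod (deriv h z))\<^sup>2) * disc_weight z \<le> (2 * ennreal ((cmod (deriv f z))\<^sup>2) + 2 * ennreal ((cmod (deriv g z))\<^sup>2)) * disc_weight z"
      by (rule mult_right_mono) simp
    then show ?thesis using True by (simp add: energy_def distrib_right mult.assoc)
  qed (simp add: energy_def)
  then have "integral\<^sup>N lborel (energy h) \<le> (\<integral>\<^sup>+z. 2 * energy f z + 2 * energy g z \<partial>lborel)"
    by (intro nn_integral_mono)
  also have "\<dots> = 2 * integral\<^sup>N lborel (energy f) + 2 * integral\<^sup>N lborel (energy g)"
    by (simp add: nn_integral_add nn_integral_cmult)
  finally show ?thesis
    unfolding Dint_le_iff nn_integral_energy by (simp add: distrib_right mult.assoc)
qed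

text \<open>Convergence is asked of the moduli only, because in one application the derivatives tend
  to the negative of \<open>deriv g\<close>.\<close>

lemma Dint_Fatou:
  assumes h: "\<And>n::nat. h n holomorphic_on ball 0 1"
    and lim: "\<And>z. z \<in> ball 0 1 \<Longrightarrow> (\<lambda>n. cmod (deriv (h n) z)) \<longlonglongrightarrow> cmod (deriv g z)"
    and le: "\<forall>\<^sub>F n in sequentially. Dint \<omega> (h n) \<le> c"
  shows "Dint \<omega> g \<le> c"
proof -
  have [measurable]: "energy (h n) \<in> borel_measurable borel" for n
    using h borel_measurable_energy by blast
  have "energy g z = liminf (\<lambda>n. energy (h n) z)" for z
  proof (cases "z \<in> ball 0 1")
    case True
    have "(\<lambda>n. energy (h n) z) \<longlonglongrightarrow> energy g z"
      unfolding energy_def using True lim[OF True]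
      by (intro tendsto_mult_ennreal tendsto_const tendsto_ennrealI tendsto_mult tendsto_power) (auto simp: disc_weight_def)
    then show ?thesis
      by (intro lim_imp_Liminf[symmetric]) auto
  qed (simp add: energy_def Liminf_const)
  then have "integral\<^sup>N lborel (energy g) = (\<integral>\<^sup>+z. liminf (\<lambda>n. energy (h n) z) \<partial>lborel)" by (intro nn_integral_cong)
  also have "\<dots> \<le> liminf (\<lambda>n. integral\<^sup>N lborel (energy (h n)))"
    by (rule nn_integral_liminf) simp
  also have "\<dots> \<le> limsup (\<lambda>n. integral\<^sup>N lborel (energy (h n)))"
    by (rule Liminf_le_Limsup) simp
  also have "\<dots> \<le> c * ennreal pi"
    using le by (intro Limsup_bounded) (simp only: Dint_le_iff)
  finally show ?thesis
    by (simp only: Dint_le_iff)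
qed

lemma deriv_diff_holomorphic: 
  assumes "f holomorphic_on ball 0 1" "g holomorphic_on ball 0 1" "z \<in> ball 0 1"
  shows "deriv (\<lambda>z. f z - g z) z = deriv f z - deriv g z"
  using assms by (intro deriv_diff) (auto simp: holomorphic_on_imp_differentiable_at)

text \<open>The disc mean inequality bounds \<open>deriv f\<close> on the smaller disc by the
  Dirichlet integral, and integration from 0 adds \<open>cmod (f 0)\<close>; hence the constant
  \<open>1 + A\<close>.\<close>

lemma cmod_le_Hnorm:
  assumes s: "0 \<le> s" "s < 1"
  obtains C where "0 \<le> C" "\<And>f z. f \<in> Hw \<omega> \<Longrightarrow> cmod z \<le> s \<Longrightarrow> cmod (f z) \<le> C * Hnorm \<omega> f"
proof -
  \<comment> \<open>Discs of radius \<rho> about points with \<open>cmod z \<le> s\<close> stay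
    inside radius \<open>t\<close>, where the weight is at least \<open>\<omega> t\<close>.\<close>
  define \<rho> where "\<rho> = (1 - s) / 2"
  define t where "t = (1 + s) / 2"
  have \<rho>: "0 < \<rho>" and t: "0 \<le> t" "t < 1" using s by (auto simp: \<rho>_def t_def)
  have wt: "0 < \<omega> t" using pos t by simp
  define A where "A = 1 / (\<rho> * sqrt (\<omega> t))"
  have A: "0 \<le> A" using \<rho> wt by (simp add: A_def)
  have db: "cmod (deriv f z) \<le> A * Hnorm \<omega> f" if f: "f \<in> Hw \<omega>" and z: "cmod z \<le> s" for f z
  proof -
    define H where "H = Hnorm \<omega> f"
    have H: "0 \<le> H" by (simp add: H_def Hnorm_nonneg)
    have hol: "f holomorphic_on ball 0 1" using f by (simp add: Hw_def)
    have inball: "cmod w < t" if "w \<in> ball z \<rho>" for w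
    proof -
      have "cmod w \<le> cmod z + cmod (z - w)"
        by (metis add.commute norm_minus_commute norm_triangle_sub)
      then show ?thesis using that z by (simp add: dist_norm \<rho>_def t_def field_simps)
    qed
    have "deriv f holomorphic_on ball 0 1" using hol by (intro holomorphic_deriv) auto
    then have "deriv f holomorphic_on ball z \<rho>"
      by (rule holomorphic_on_subset) (use inball t in force)
    then have "ennreal ((cmod (deriv f z))\<^sup>2) * ennreal (pi * \<rho>\<^sup>2) \<le> (\<integral>\<^sup>+w\<in>ball z \<rho>. ennreal ((cmod (deriv f w))\<^sup>2) \<partial>lborel)"
      using \<rho> by (rule cmod_square_le_disc_mean)
    also have "\<dots> \<le> (\<integral>\<^sup>+w. ennreal (1 / \<omega> t) * energy f w \<partial>lborel)"
    proof (rule nn_integral_mono)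
      fix w
      show "ennreal ((cmod (deriv f w))\<^sup>2) * indicator (ball z \<rho>) w \<le>
         ennreal (1 / \<omega> t) * energy f w"
      proof (cases "w \<in> ball z \<rho>")
        case True
        have wl: "cmod w < t" by (rule inball[OF True])
        then have "\<omega> t \<le> \<omega> (cmod w)" using antimono[of "cmod w" t] t by simp
        then have "(cmod (deriv f w))\<^sup>2 * 1 \<le> (cmod (deriv f w))\<^sup>2 * (\<omega> (cmod w) / \<omega> t)"
          using wt by (intro mult_left_mono) auto
        then have "(cmod (deriv f w))\<^sup>2 \<le> 1 / \<omega> t * ((cmod (deriv f w))\<^sup>2 * \<omega> (cmod w))"
          by simp
        then have "ennreal ((cmod (deriv f w))\<^sup>2) \<le> ennreal (1 / \<omega> t * ((cmod (deriv f w))\<^sup>2 * \<omega> (cmod w)))"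
          by (rule ennreal_leI)
        also have "\<dots> = ennreal (1 / \<omega> t) * (ennreal ((cmod (deriv f w))\<^sup>2) * ennreal (\<omega> (cmod w)))"
          using wt pos[of "cmod w"] wl t by (subst ennreal_mult; (subst ennreal_mult)?; simp)
        finally show ?thesis using True wl t by (simp add: energy_def disc_weight_def)
      qed simp
    qed
    also have "\<dots> = ennreal (1 / \<omega> t) * (Dint \<omega> f * ennreal pi)"
      unfolding nn_integral_energy[symmetric]
      using borel_measurable_energy[OF hol] by (intro nn_integral_cmult) simp
    also have "\<dots> \<le> ennreal (1 / \<omega> t) * (ennreal (H\<^sup>2) * ennreal pi)"
      using Dint_le_Hnorm_square[OF f] by (intro mult_left_mono mult_right_mono) (auto simp: H_def)
    also have "\<dots> = ennreal (1 / \<omega> t * (H\<^sup>2 * pi))"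
      using wt by (subst ennreal_mult; (subst ennreal_mult)?; simp)
    finally have "ennreal ((cmod (deriv f z))\<^sup>2 * (pi * \<rho>\<^sup>2)) \<le> ennreal (1 / \<omega> t * (H\<^sup>2 * pi))"
      by (simp add: ennreal_mult)
    then have "(cmod (deriv f z))\<^sup>2 * (pi * \<rho>\<^sup>2) \<le> 1 / \<omega> t * (H\<^sup>2 * pi)"
      using wt by (subst (asm) ennreal_le_iff) auto
    then have "(cmod (deriv f z))\<^sup>2 * \<rho>\<^sup>2 * pi \<le> (1 / \<omega> t * H\<^sup>2) * pi"
      by (simp add: mult_ac)
    then have "(cmod (deriv f z))\<^sup>2 * \<rho>\<^sup>2 \<le> 1 / \<omega> t * H\<^sup>2"
      by (simp only: mult_le_cancel_right_pos[OF pi_gt_zero])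
    then have "(cmod (deriv f z))\<^sup>2 \<le> 1 / \<omega> t * H\<^sup>2 / \<rho>\<^sup>2"
      by (subst pos_le_divide_eq) (use \<rho> in auto)
    also have "\<dots> = (A * H)\<^sup>2"
      using wt \<rho> by (simp add: A_def power_mult_distrib power_divide)
    finally show ?thesis using A H unfolding H_def by (intro power2_le_imp_le[OF _ mult_nonneg_nonneg])
  qed
  show thesis
  proof (rule that[of "1 + A"])
    show "0 \<le> 1 + A" using A by simp
    fix f z assume f: "f \<in> Hw \<omega>" and z: "cmod z \<le> s"
    have hol: "f holomorphic_on ball 0 1" using f by (simp add: Hw_def)
    have "cmod (f z - f 0) \<le> A * Hnorm \<omega> f * cmod (z - 0)"
    proof (rule field_differentiable_bound[of "cball 0 s"])
      fix w :: complex assume "w \<in> cball 0 s"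
      then have w: "w \<in> ball 0 1" "cmod w \<le> s" using s by auto
      show "(f has_field_derivative deriv f w) (at w within cball 0 s)"
        by (rule has_field_derivative_at_within[OF holomorphic_derivI[OF hol open_ball w(1)]])
      show "cmod (deriv f w) \<le> A * Hnorm \<omega> f"
        by (rule db[OF f w(2)])
    qed (use z s in auto)
    also have "\<dots> \<le> A * Hnorm \<omega> f * 1"
      using z s A Hnorm_nonneg by (intro mult_left_mono) auto
    finally have "cmod (f z - f 0) \<le> A * Hnorm \<omega> f" by simp
    moreover have "cmod (f z) \<le> cmod (f 0) + cmod (f z - f 0)"
      by (metis norm_triangle_sub)
    ultimately show "cmod (f z) \<le> (1 + A) * Hnorm \<omega> f"
      using cmod_0_le_Hnorm[of f] by (simp add: algebra_simps)
  qed
qed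

end

section \<open>Boundedness\<close>

context composition_symbol
begin

lemma Dint_comp_le:
  assumes f: "f holomorphic_on ball 0 1" and r: "1/2 \<le> r" "r < 1"
    and Q: "\<And>\<delta> \<zeta>. 0 < \<delta> \<Longrightarrow> \<delta> < 2 * (1 - r) \<Longrightarrow> cmod \<zeta> = 1 \<Longrightarrow> carleson_quot \<omega> \<phi> \<delta> \<zeta> \<le> ennreal Q"
    and "0 \<le> Q"
  shows "Dint \<omega> (f \<circ> \<phi>) * ennreal pi \<le> ennreal (36 * 4 ^ q * Q) * (Dint \<omega> f * ennreal pi)
    + ennreal (9 / (pi * (1 - r)\<^sup>2)) * total_mass *
      (\<integral>\<^sup>+w\<in>cball 0 r. ennreal (indicator (ball 0 1) w * (cmod (deriv f w))\<^sup>2) \<partial>lborel)"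
proof -
  have "deriv f holomorphic_on ball 0 1" using f by (intro holomorphic_deriv) auto
  note embedding = carleson_embedding[OF this r Q \<open>0 \<le> Q\<close>]
  have "(\<integral>\<^sup>+w. ennreal (indicator (ball 0 1) w * (cmod (deriv f w))\<^sup>2) * disc_weight w \<partial>lborel) = Dint \<omega> f * ennreal pi"
    using nn_integral_energy[of f] unfolding energy_def .
  moreover have "(\<integral>\<^sup>+w. ennreal (indicator (ball 0 1) w * (cmod (deriv f w))\<^sup>2) * count_density w \<partial>lborel) = Dint \<omega> (f \<circ> \<phi>) * ennreal pi"
    by (simp add: Dint_comp[OF f] ennreal_divide_times ennreal_divide_self)
  ultimately show ?thesis
    using embedding by (simp only:)
qed

text \<open>The interior term of the embedding is also controlled by the Dirichlet integral of
  \<open>f\<close>, since the weight is at least \<open>\<omega> r\<close> on the closed disc of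
  radius \<open>r\<close>.\<close>

lemma Dint_comp_bounded:
  assumes r: "1/2 \<le> r" "r < 1"
    and Q: "\<And>\<delta> \<zeta>. 0 < \<delta> \<Longrightarrow> \<delta> < 2 * (1 - r) \<Longrightarrow> cmod \<zeta> = 1 \<Longrightarrow> carleson_quot \<omega> \<phi> \<delta> \<zeta> \<le> ennreal Q"
    and "0 \<le> Q"
  obtains C where "0 \<le> C" "\<And>f. f holomorphic_on ball 0 1 \<Longrightarrow> Dint \<omega> (f \<circ> \<phi>) \<le> ennreal C * Dint \<omega> f"
proof -
  define m where "m = enn2real total_mass"
  have m: "total_mass = ennreal m" "0 \<le> m"
    using total_mass_finite by (simp_all add: m_def)
  have wr: "0 < \<omega> r" using pos r by simp
  define C where "C = 36 * 4 ^ q * Q + 9 / (pi * (1 - r)\<^sup>2) * m * (1 / \<omega> r)"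
  show thesis
  proof (rule that[of C])
    show "0 \<le> C" using m wr \<open>0 \<le> Q\<close> by (simp add: C_def)
    fix f assume f: "f holomorphic_on ball 0 1"
    let ?G = "\<lambda>w. ennreal (indicator (ball 0 1) w * (cmod (deriv f w))\<^sup>2)"
    have "(\<integral>\<^sup>+w\<in>cball 0 r. ?G w \<partial>lborel) \<le> (\<integral>\<^sup>+w. ennreal (1 / \<omega> r) * (?G w * disc_weight w) \<partial>lborel)"
    proof (rule nn_integral_mono)
      fix w :: complex
      show "?G w * indicator (cball 0 r) w \<le> ennreal (1 / \<omega> r) * (?G w * disc_weight w)"
      proof (cases "w \<in> cball 0 r")
        case True
        then have "\<omega> r \<le> \<omega> (cmod w)" using antimono[of "cmod w" r] r by simp
        then have "1 \<le> ennreal (1 / \<omega> r * \<omega> (cmod w))" using wr by simp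
        also have "\<dots> = ennreal (1 / \<omega> r) * disc_weight w"
          using wr True r pos[of "cmod w"] by (simp add: disc_weight_def ennreal_mult[symmetric])
        finally have "?G w * 1 \<le> ?G w * (ennreal (1 / \<omega> r) * disc_weight w)"
          by (rule mult_left_mono) simp
        then show ?thesis using True by (simp add: mult_ac)
      qed simp
    qed
    also have "\<dots> = ennreal (1 / \<omega> r) * (Dint \<omega> f * ennreal pi)"
    proof -
      have "energy f \<in> borel_measurable lborel" using borel_measurable_energy[OF f] by simp
      then show ?thesis
        unfolding nn_integral_energy[symmetric] energy_def[abs_def] by (rule nn_integral_cmult)
    qed
    finally have G: "(\<integral>\<^sup>+w\<in>cball 0 r. ?G w \<partial>lborel) \<le> ennreal (1 / \<omega> r) * (Dint \<omega> f * ennreal pi)" .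
    have "Dint \<omega> (f \<circ> \<phi>) * ennreal pi \<le> ennreal (36 * 4 ^ q * Q) * (Dint \<omega> f * ennreal pi)
       + ennreal (9 / (pi * (1 - r)\<^sup>2)) * total_mass * (\<integral>\<^sup>+w\<in>cball 0 r. ?G w \<partial>lborel)"
      by (rule Dint_comp_le[OF f r Q \<open>0 \<le> Q\<close>])
    also have "\<dots> \<le> ennreal (36 * 4 ^ q * Q) * (Dint \<omega> f * ennreal pi)
       + ennreal (9 / (pi * (1 - r)\<^sup>2)) * total_mass * (ennreal (1 / \<omega> r) * (Dint \<omega> f * ennreal pi))"
      by (intro add_left_mono mult_left_mono G) auto
    also have "\<dots> = (ennreal (36 * 4 ^ q * Q) + ennreal (9 / (pi * (1 - r)\<^sup>2)) * ennreal m * ennreal (1 / \<omega> r)) * (Dint \<omega> f * ennreal pi)"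
      by (simp add: m distrib_right mult.assoc)
    also have "ennreal (36 * 4 ^ q * Q) + ennreal (9 / (pi * (1 - r)\<^sup>2)) * ennreal m * ennreal (1 / \<omega> r) = ennreal C"
      unfolding C_def using m(2) wr \<open>0 \<le> Q\<close>
      by (subst ennreal_plus; (subst ennreal_mult)?; (subst ennreal_mult)?; simp)
    finally have "Dint \<omega> (f \<circ> \<phi>) * ennreal pi / ennreal pi \<le> ennreal C * Dint \<omega> f"
      by (simp only: ennreal_divide_le_iff[OF pi_gt_zero] mult.assoc)
    then show "Dint \<omega> (f \<circ> \<phi>) \<le> ennreal C * Dint \<omega> f"
      by (simp add: ennreal_mult_divide_eq)
  qed
qed

text \<open>The norm of the composition also contains the value \<open>f (\<phi> 0)\<close>, which
  is controlled by boundedness of point evaluations.\<close>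

lemma comp_boundedI:
  assumes r: "1/2 \<le> r" "r < 1"
    and Q: "\<And>\<delta> \<zeta>. 0 < \<delta> \<Longrightarrow> \<delta> < 2 * (1 - r) \<Longrightarrow> cmod \<zeta> = 1 \<Longrightarrow> carleson_quot \<omega> \<phi> \<delta> \<zeta> \<le> ennreal Q"
    and "0 \<le> Q"
  shows "comp_bounded \<omega> \<phi>"
proof -
  obtain C where C: "0 \<le> C" "\<And>f. f holomorphic_on ball 0 1 \<Longrightarrow> Dint \<omega> (f \<circ> \<phi>) \<le> ennreal C * Dint \<omega> f"
    using Dint_comp_bounded[OF assms] by blast
  have "cmod (\<phi> 0) < 1" using range by force
  then obtain C1 where C1: "0 \<le> C1" "\<And>f. f \<in> Hw \<omega> \<Longrightarrow> cmod (f (\<phi> 0)) \<le> C1 * Hnorm \<omega> f"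
    using cmod_le_Hnorm[of "cmod (\<phi> 0)"] by (metis norm_ge_zero order_refl)
  have le: "Dint \<omega> (f \<circ> \<phi>) \<le> ennreal (C * (Hnorm \<omega> f)\<^sup>2)" if f: "f \<in> Hw \<omega>" for f
  proof -
    have "Dint \<omega> (f \<circ> \<phi>) \<le> ennreal C * Dint \<omega> f" using f C by (simp add: Hw_def)
    also have "\<dots> \<le> ennreal C * ennreal ((Hnorm \<omega> f)\<^sup>2)"
      by (intro mult_left_mono Dint_le_Hnorm_square f) auto
    finally show ?thesis using C by (simp add: ennreal_mult)
  qed
  have "f \<circ> \<phi> \<in> Hw \<omega>" if "f \<in> Hw \<omega>" for f
    using le[OF that] holomorphic_comp[of f] that by (auto simp: Hw_def intro: le_less_trans)
  moreover have "Hnorm \<omega> (f \<circ> \<phi>) \<le> sqrt (C1\<^sup>2 + C) * Hnorm \<omega> f" if f: "f \<in> Hw \<omega>" for f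
  proof -
    have "enn2real (Dint \<omega> (f \<circ> \<phi>)) \<le> C * (Hnorm \<omega> f)\<^sup>2"
      using le[OF f] C by (intro enn2real_leI) auto
    moreover have "(cmod (f (\<phi> 0)))\<^sup>2 \<le> (C1 * Hnorm \<omega> f)\<^sup>2"
      using C1(2)[OF f] by (intro power_mono) auto
    ultimately have "(Hnorm \<omega> (f \<circ> \<phi>))\<^sup>2 \<le> (C1\<^sup>2 + C) * (Hnorm \<omega> f)\<^sup>2"
      unfolding Hnorm_square[of "f \<circ> \<phi>"] by (simp add: power_mult_distrib distrib_right)
    then have "Hnorm \<omega> (f \<circ> \<phi>) \<le> sqrt ((C1\<^sup>2 + C) * (Hnorm \<omega> f)\<^sup>2)"
      by (rule real_le_rsqrt)
    then show ?thesis by (simp add: real_sqrt_mult Hnorm_nonneg)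
  qed
  ultimately show ?thesis unfolding comp_bounded_def by blast
qed

lemma carleson_quot_bounded:
  assumes "comp_bounded \<omega> \<phi>"
  obtains C where "\<And>\<delta> \<zeta>. 0 < \<delta> \<Longrightarrow> \<delta> < 1 \<Longrightarrow> cmod \<zeta> = 1 \<Longrightarrow> carleson_quot \<omega> \<phi> \<delta> \<zeta> \<le> ennreal C"
proof -
  obtain C where C: "\<And>f. f \<in> Hw \<omega> \<Longrightarrow> f \<circ> \<phi> \<in> Hw \<omega>"
    "\<And>f. f \<in> Hw \<omega> \<Longrightarrow> Hnorm \<omega> (f \<circ> \<phi>) \<le> C * Hnorm \<omega> f"
    using assms unfolding comp_bounded_def by blast
  show thesis
  proof (rule that[of "4 ^ (q + 2) * C\<^sup>2"])
    fix \<delta> :: real and \<zeta> :: complex assume *: "0 < \<delta>" "\<delta> < 1" "cmod \<zeta> = 1"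
    let ?f = "test_fun \<delta> \<zeta>"
    have f: "?f \<in> Hw \<omega>" by (rule test_fun_in_Hw[OF *])
    have "Hnorm \<omega> (?f \<circ> \<phi>) \<le> C * Hnorm \<omega> ?f" by (rule C(2)[OF f])
    \<comment> \<open>The definition of boundedness does not fix the sign of
      \<open>C\<close>.\<close>
    also have "\<dots> \<le> \<bar>C\<bar> * 1"
      using Hnorm_test_fun_le_1[OF *] Hnorm_nonneg[of ?f] by (intro mult_mono) auto
    finally have "(Hnorm \<omega> (?f \<circ> \<phi>))\<^sup>2 \<le> \<bar>C\<bar>\<^sup>2"
      using Hnorm_nonneg by (intro power_mono) auto
    then have "Dint \<omega> (?f \<circ> \<phi>) \<le> ennreal (C\<^sup>2)"
      using Dint_le_Hnorm_square[OF C(1)[OF f]] by (metis ennreal_leI order_trans power2_abs)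
    then have "ennreal (4 ^ (q + 2)) * Dint \<omega> (?f \<circ> \<phi>) \<le> ennreal (4 ^ (q + 2)) * ennreal (C\<^sup>2)"
      by (rule mult_left_mono) simp
    then show "carleson_quot \<omega> \<phi> \<delta> \<zeta> \<le> ennreal (4 ^ (q + 2) * C\<^sup>2)"
      using carleson_quot_le_Dint_test_fun[OF *] by (simp only: ennreal_mult zero_le_power2 zero_le_power zero_le_numeral)
  qed
qed

end

section \<open>Compactness\<close>

lemma compact_subset_unit_ball:
  assumes "compact K" "K \<subseteq> ball (0::complex) 1"
  obtains s where "0 \<le> s" "s < 1" "\<And>z. z \<in> K \<Longrightarrow> cmod z \<le> s"
proof (cases "K = {}")
  case True
  then show thesis using that[of 0] by simp
next
  case False
  have "continuous_on K cmod" by (intro continuous_intros)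
  then obtain x where "x \<in> K" "\<And>y. y \<in> K \<Longrightarrow> cmod y \<le> cmod x"
    using continuous_attains_sup[OF assms(1) False] by blast
  then show thesis using that[of "cmod x"] assms(2) by auto
qed

text \<open>Cauchy's estimate on discs of radius \<rho>, which stay in the disc of radius
  \<open>s + \<rho> < 1\<close>. The functions are made smaller than \<open>\<eta> * \<rho>\<close>
  because the estimate divides by \<rho>.\<close>

lemma deriv_uniformly_small:
  assumes h: "\<And>n::nat. h n holomorphic_on ball 0 1"
    and lim: "\<And>s. s < 1 \<Longrightarrow> uniform_limit (cball 0 s) h (\<lambda>_. 0) sequentially"
    and s: "0 \<le> s" "s < 1" and "0 < \<eta>"
  shows "\<forall>\<^sub>F n in sequentially. \<forall>z\<in>cball 0 s. cmod (deriv (h n) z) \<le> \<eta>"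
proof -
  define \<rho> where "\<rho> = (1 - s) / 2"
  have \<rho>: "0 < \<rho>" "s + \<rho> < 1" using s by (auto simp: \<rho>_def field_simps)
  have "\<forall>\<^sub>F n in sequentially. \<forall>x\<in>cball 0 (s + \<rho>). dist (h n x) 0 < \<eta> * \<rho>"
    using lim[OF \<rho>(2)] \<rho>(1) \<open>0 < \<eta>\<close> by (intro uniform_limitD) auto
  then show ?thesis
  proof eventually_elim
    case (elim n)
    show ?case
    proof
      fix z :: complex assume z: "z \<in> cball 0 s"
      have sub: "cball z \<rho> \<subseteq> cball 0 (s + \<rho>)" "cball z \<rho> \<subseteq> ball 0 1"
      proof -
        have "cmod w \<le> s + \<rho>" if "w \<in> cball z \<rho>" for w
        proof -
          have "cmod w \<le> cmod z + cmod (z - w)"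
            by (metis add.commute norm_minus_commute norm_triangle_sub)
          then show ?thesis using that z by (simp add: dist_norm)
        qed
        then show "cball z \<rho> \<subseteq> cball 0 (s + \<rho>)" "cball z \<rho> \<subseteq> ball 0 1"
          using \<rho>(2) by fastforce+
      qed
      have "cmod ((deriv ^^ 1) (h n) z) \<le> fact 1 * (\<eta> * \<rho>) / \<rho> ^ 1"
      proof (rule Cauchy_inequality)
        show "h n holomorphic_on ball z \<rho>"
          using sub(2) ball_subset_cball by (blast intro: holomorphic_on_subset[OF h])
        show "continuous_on (cball z \<rho>) (h n)"
          using continuous_on_subset[OF holomorphic_on_imp_continuous_on[OF h] sub(2)] .
        fix x assume "cmod (z - x) = \<rho>"
        then have "x \<in> cball 0 (s + \<rho>)" using sub(1) by (auto simp: dist_norm)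
        then show "cmod (h n x) \<le> \<eta> * \<rho>" using elim by fastforce
      qed (use \<rho> in auto)
      then show "cmod (deriv (h n) z) \<le> \<eta>" using \<rho> by simp
    qed
  qed
qed

context composition_symbol
begin

text \<open>After passing to a subsequence, the differences from the Montel limit have bounded
  Dirichlet integrals and derivatives tending to 0 uniformly on compact sets. The embedding weighs
  the first fact by a small \<open>Q\<close> and applies the second to its interior term.\<close>

lemma comp_compactI:
  assumes van: "\<And>\<epsilon>. 0 < \<epsilon> \<Longrightarrow> \<exists>d>0. \<forall>\<delta> \<zeta>. 0 < \<delta> \<longrightarrow> \<delta> < d \<longrightarrow> cmod \<zeta> = 1 \<longrightarrow> carleson_quot \<omega> \<phi> \<delta> \<zeta> \<le> ennreal \<epsilon>"
  shows "comp_compact \<omega> \<phi>"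
proof -
  have van': "\<exists>r\<ge>1/2. r < 1 \<and> (\<forall>\<delta> \<zeta>. 0 < \<delta> \<longrightarrow> \<delta> < 2 * (1 - r) \<longrightarrow> cmod \<zeta> = 1 \<longrightarrow> carleson_quot \<omega> \<phi> \<delta> \<zeta> \<le> ennreal \<epsilon>)"
    if \<epsilon>: "0 < \<epsilon>" for \<epsilon>
  proof -
    obtain d where d: "0 < d" "\<And>\<delta> \<zeta>. 0 < \<delta> \<Longrightarrow> \<delta> < d \<Longrightarrow> cmod \<zeta> = 1 \<Longrightarrow> carleson_quot \<omega> \<phi> \<delta> \<zeta> \<le> ennreal \<epsilon>"
      using van[OF \<epsilon>] by blast
    show ?thesis
      \<comment> \<open>For this \<open>r\<close>, \<open>2 * (1 - r)\<close> is the minimum of 1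
        and \<open>d\<close>.\<close>
      using d by (intro exI[of _ "max (1/2) (1 - d/2)"]) (auto simp: max_def split: if_splits)
  qed
  obtain r1 where r1: "1/2 \<le> r1" "r1 < 1" "\<And>\<delta> \<zeta>. 0 < \<delta> \<Longrightarrow> \<delta> < 2 * (1 - r1) \<Longrightarrow> cmod \<zeta> = 1 \<Longrightarrow> carleson_quot \<omega> \<phi> \<delta> \<zeta> \<le> ennreal 1"
    using van'[of 1] by auto
  have "comp_bounded \<omega> \<phi>" by (rule comp_boundedI[OF r1]) auto
  then have comp_in: "f \<circ> \<phi> \<in> Hw \<omega>" if "f \<in> Hw \<omega>" for f
    using that by (simp add: comp_bounded_def)
  have "\<exists>r g. strict_mono r \<and> g \<in> Hw \<omega> \<and> (\<lambda>n. Hnorm \<omega> (\<lambda>z. (F (r n) \<circ> \<phi>) z - g z)) \<longlonglongrightarrow> 0"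
    if F: "\<And>n. F n \<in> Hw \<omega>" and B: "\<And>n. Hnorm \<omega> (F n) \<le> B" for F :: "nat \<Rightarrow> complex \<Rightarrow> complex" and B
  proof -
    have holF: "F n holomorphic_on ball 0 1" for n using F by (simp add: Hw_def)
    obtain g r where g: "g holomorphic_on ball 0 1" and r: "strict_mono (r :: nat \<Rightarrow> nat)"
      and pw: "\<And>x. x \<in> ball 0 1 \<Longrightarrow> ((\<lambda>n. F (r n) x) \<longlongrightarrow> g x) sequentially"
      and ul: "\<And>K. compact K \<Longrightarrow> K \<subseteq> ball 0 1 \<Longrightarrow> uniform_limit K (F \<circ> r) g sequentially"
    \<comment> \<open>Point evaluations are uniformly bounded on compact sets, so a norm-bounded
      sequence is locally bounded.\<close>
    proof (rule Montel[of "ball 0 1" "range F" F])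
      fix K assume "compact K" "K \<subseteq> ball (0::complex) 1"
      then obtain s where s: "0 \<le> s" "s < 1" "\<And>z. z \<in> K \<Longrightarrow> cmod z \<le> s"
        using compact_subset_unit_ball by blast
      obtain C where C: "0 \<le> C" "\<And>f z. f \<in> Hw \<omega> \<Longrightarrow> cmod z \<le> s \<Longrightarrow> cmod (f z) \<le> C * Hnorm \<omega> f"
        using cmod_le_Hnorm[OF s(1,2)] by blast
      have "cmod (F n z) \<le> C * B" if "z \<in> K" for n z
        using C(2)[OF F s(3)[OF that], of n] mult_left_mono[OF B[of n] C(1)] by linarith
      then show "\<exists>B. \<forall>h\<in>range F. \<forall>z\<in>K. cmod (h z) \<le> B" by blast
    qed (use holF in auto)
    define h where "h n z = F (r n) z - g z" for n z
    have holh: "h n holomorphic_on ball 0 1" for n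
      unfolding h_def by (intro holomorphic_intros holF g)
    have dh: "deriv (h n) z = deriv (F (r n)) z - deriv g z" if "z \<in> ball 0 1" for n z
      unfolding h_def by (rule deriv_diff_holomorphic[OF holF g that])
    have ulh: "uniform_limit (cball 0 s) h (\<lambda>_. 0) sequentially" if "s < 1" for s
    proof -
      have "uniform_limit (cball 0 s) (F \<circ> r) g sequentially"
        using that by (intro ul) auto
      then show ?thesis unfolding uniform_limit_iff by (simp add: h_def dist_norm)
    qed
    note small = deriv_uniformly_small[OF holh ulh]
    have dlim: "(\<lambda>n. cmod (deriv (F (r n)) z)) \<longlonglongrightarrow> cmod (deriv g z)" if z: "z \<in> ball 0 1" for z
    proof (intro tendsto_norm tendstoI)
      fix e :: real assume "0 < e"
      have "\<forall>\<^sub>F n in sequentially. \<forall>w\<in>cball 0 (cmod z). cmod (deriv (h n) w) \<le> e / 2"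
        using z \<open>0 < e\<close> by (intro small) auto
      then show "\<forall>\<^sub>F n in sequentially. dist (deriv (F (r n)) z) (deriv g z) < e"
      proof eventually_elim
        case (elim n)
        then have "cmod (deriv (h n) z) \<le> e / 2" by simp
        then show ?case using \<open>0 < e\<close> by (simp add: dh[OF z] dist_norm)
      qed
    qed
    have DF: "Dint \<omega> (F n) \<le> ennreal (B\<^sup>2)" for n
      using Dint_le_Hnorm_square[OF F] B[of n] Hnorm_nonneg[of "F n"]
      by (meson ennreal_leI order_trans power_mono)
    have Dg: "Dint \<omega> g \<le> ennreal (B\<^sup>2)"
      by (rule Dint_Fatou[of "\<lambda>n. F (r n)"]) (use holF dlim DF in auto)
    then have gHw: "g \<in> Hw \<omega>" using g by (auto simp: Hw_def intro: le_less_trans)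
    have Dh: "Dint \<omega> (h n) \<le> ennreal (4 * B\<^sup>2)" for n
    proof -
      have "Dint \<omega> (h n) \<le> 2 * Dint \<omega> (F (r n)) + 2 * Dint \<omega> g"
        by (rule Dint_le_2_add[OF holF g]) (simp add: dh norm_triangle_ineq4)
      also have "\<dots> \<le> 2 * ennreal (B\<^sup>2) + 2 * ennreal (B\<^sup>2)"
        by (intro add_mono mult_left_mono DF Dg) auto
      also have "\<dots> = ennreal 2 * ennreal (B\<^sup>2) + ennreal 2 * ennreal (B\<^sup>2)" by simp
      also have "\<dots> = ennreal (2 * B\<^sup>2 + 2 * B\<^sup>2)"
        by (simp only: ennreal_mult[symmetric] ennreal_plus[symmetric] zero_le_power2 zero_le_numeral mult_nonneg_nonneg)
      also have "2 * B\<^sup>2 + 2 * B\<^sup>2 = 4 * B\<^sup>2" by simp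
      finally show ?thesis .
    qed
    have Dcomp: "\<forall>\<^sub>F n in sequentially. Dint \<omega> (h n \<circ> \<phi>) \<le> ennreal \<epsilon>" if \<epsilon>: "0 < \<epsilon>" for \<epsilon>
    proof -
      \<comment> \<open>\<open>L\<close> and \<open>A\<close> are the coefficients multiplying
        \<open>Q\<close> and \<open>\<eta>^2\<close> in the final bound. Both parameters are chosen
        to make each term at most \<open>\<epsilon> / 2\<close>; adding 1 avoids a zero
        denominator.\<close>
      define L where "L = 36 * 4 ^ q * (4 * B\<^sup>2)"
      have L: "0 \<le> L" by (simp add: L_def)
      define Q where "Q = \<epsilon> / (2 * (L + 1))"
      have Q: "0 < Q" using L \<epsilon> by (simp add: Q_def)
      obtain r0 where r0: "1/2 \<le> r0" "r0 < 1" "\<And>\<delta> \<zeta>. 0 < \<delta> \<Longrightarrow> \<delta> < 2 * (1 - r0) \<Longrightarrow> cmod \<zeta> = 1 \<Longrightarrow> carleson_quot \<omega> \<phi> \<delta> \<zeta> \<le> ennreal Q"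
        using van'[OF Q] by blast
      define m where "m = enn2real total_mass"
      have m: "total_mass = ennreal m" "0 \<le> m"
        using total_mass_finite by (simp_all add: m_def)
      define A where "A = 9 / (pi * (1 - r0)\<^sup>2) * m"
      have A: "0 \<le> A" using m by (simp add: A_def)
      define \<eta> where "\<eta> = sqrt (\<epsilon> / (2 * (A + 1)))"
      have \<eta>: "0 < \<eta>" "\<eta>\<^sup>2 = \<epsilon> / (2 * (A + 1))" using A \<epsilon> by (simp_all add: \<eta>_def)
      have "\<forall>\<^sub>F n in sequentially. \<forall>z\<in>cball 0 r0. cmod (deriv (h n) z) \<le> \<eta>"
        using r0 \<eta> by (intro small) auto
      then show ?thesis
      proof eventually_elim
        case (elim n)
        let ?G = "\<lambda>w. ennreal (indicator (ball 0 1) w * (cmod (deriv (h n) w))\<^sup>2)"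
        have "(\<integral>\<^sup>+w\<in>cball 0 r0. ?G w \<partial>lborel) \<le> (\<integral>\<^sup>+w\<in>ball (0::complex) 1. ennreal (\<eta>\<^sup>2) \<partial>lborel)"
        proof (rule nn_integral_mono)
          fix w :: complex
          show "?G w * indicator (cball 0 r0) w \<le> ennreal (\<eta>\<^sup>2) * indicator (ball 0 1) w"
          proof (cases "w \<in> cball 0 r0")
            case True
            then have "(cmod (deriv (h n) w))\<^sup>2 \<le> \<eta>\<^sup>2" using elim by (intro power_mono) auto
            then show ?thesis using True r0 by (simp add: ennreal_leI)
          qed simp
        qed
        also have "\<dots> = ennreal (\<eta>\<^sup>2) * ennreal pi"
          by (subst nn_integral_cmult_indicator) (auto simp: emeasure_ball unit_ball_vol_2)
        finally have G: "(\<integral>\<^sup>+w\<in>cball 0 r0. ?G w \<partial>lborel) \<le> ennreal (\<eta>\<^sup>2) * ennreal pi" .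
        have "Dint \<omega> (h n \<circ> \<phi>) * ennreal pi \<le> ennreal (36 * 4 ^ q * Q) * (Dint \<omega> (h n) * ennreal pi)
           + ennreal (9 / (pi * (1 - r0)\<^sup>2)) * total_mass * (\<integral>\<^sup>+w\<in>cball 0 r0. ?G w \<partial>lborel)"
          using Q by (intro Dint_comp_le[OF holh r0]) auto
        also have "\<dots> \<le> ennreal (36 * 4 ^ q * Q) * (ennreal (4 * B\<^sup>2) * ennreal pi)
           + ennreal (9 / (pi * (1 - r0)\<^sup>2)) * total_mass * (ennreal (\<eta>\<^sup>2) * ennreal pi)"
          by (intro add_mono mult_left_mono mult_right_mono Dh G) auto
        also have "\<dots> = ennreal ((36 * 4 ^ q * Q) * (4 * B\<^sup>2) + (9 / (pi * (1 - r0)\<^sup>2)) * m * \<eta>\<^sup>2) * ennreal pi"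
          using Q m(2) unfolding m(1)
          by (subst ennreal_plus; (subst ennreal_mult)?; (subst ennreal_mult)?; (subst ennreal_mult)?; simp add: distrib_right mult.assoc)
        also have "(36 * 4 ^ q * Q) * (4 * B\<^sup>2) + (9 / (pi * (1 - r0)\<^sup>2)) * m * \<eta>\<^sup>2 = L * Q + A * \<eta>\<^sup>2"
          by (simp add: L_def A_def)
        finally have le: "Dint \<omega> (h n \<circ> \<phi>) * ennreal pi \<le> ennreal (L * Q + A * \<eta>\<^sup>2) * ennreal pi" .
        have "L * Q \<le> \<epsilon> / 2" "A * \<eta>\<^sup>2 \<le> \<epsilon> / 2"
          unfolding Q_def \<eta>(2) using L A \<epsilon> by (simp_all add: field_simps)
        then have "ennreal (L * Q + A * \<eta>\<^sup>2) * ennreal pi \<le> ennreal \<epsilon> * ennreal pi"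
          by (intro mult_right_mono ennreal_leI) auto
        with le have "Dint \<omega> (h n \<circ> \<phi>) * ennreal pi / ennreal pi \<le> ennreal \<epsilon>"
          unfolding ennreal_divide_le_iff[OF pi_gt_zero] by (rule order_trans)
        then show ?case by (simp add: ennreal_mult_divide_eq)
      qed
    qed
    have "(\<lambda>n. enn2real (Dint \<omega> (h n \<circ> \<phi>))) \<longlonglongrightarrow> 0"
    proof (rule tendstoI)
      fix e :: real assume e: "0 < e"
      have "\<forall>\<^sub>F n in sequentially. Dint \<omega> (h n \<circ> \<phi>) \<le> ennreal (e / 2)"
        using e by (intro Dcomp) auto
      then show "\<forall>\<^sub>F n in sequentially. dist (enn2real (Dint \<omega> (h n \<circ> \<phi>))) 0 < e"
      proof eventually_elim
        case (elim n)
        then have "enn2real (Dint \<omega> (h n \<circ> \<phi>)) \<le> e / 2" using e by (intro enn2real_leI) auto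
        then show ?case using e by simp
      qed
    qed
    moreover have "(\<lambda>n. h n (\<phi> 0)) \<longlonglongrightarrow> 0"
    proof -
      have "\<phi> 0 \<in> ball 0 1" using range by force
      then have "(\<lambda>n. F (r n) (\<phi> 0) - g (\<phi> 0)) \<longlonglongrightarrow> g (\<phi> 0) - g (\<phi> 0)"
        by (intro tendsto_diff pw tendsto_const)
      then show ?thesis by (simp add: h_def)
    qed
    ultimately have "(\<lambda>n. sqrt ((cmod (h n (\<phi> 0)))\<^sup>2 + enn2real (Dint \<omega> (h n \<circ> \<phi>)))) \<longlonglongrightarrow> sqrt ((cmod 0)\<^sup>2 + 0)"
      by (intro tendsto_real_sqrt tendsto_add tendsto_power tendsto_norm)
    \<comment> \<open>The limit demanded by \<open>comp_compact\<close> is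
      \<open>g \<circ> \<phi>\<close>, with \<open>g\<close> the Montel limit.\<close>
    moreover have "(\<lambda>z. (F (r n) \<circ> \<phi>) z - (g \<circ> \<phi>) z) = h n \<circ> \<phi>" for n
      by (auto simp: h_def)
    ultimately have "(\<lambda>n. Hnorm \<omega> (\<lambda>z. (F (r n) \<circ> \<phi>) z - (g \<circ> \<phi>) z)) \<longlonglongrightarrow> 0"
      by (simp add: Hnorm_def)
    then show ?thesis using r comp_in[OF gHw] by blast
  qed
  then show ?thesis
    unfolding comp_compact_def using comp_in by blast
qed

text \<open>The test functions concentrating at the boundary have derivatives tending to 0 pointwise, so
  by Fatou every norm limit of their images is constant.\<close>

lemma carleson_quot_vanishing:
  assumes comp: "comp_compact \<omega> \<phi>" and \<epsilon>: "0 < \<epsilon>"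
  obtains d where "0 < d" "\<And>\<delta> \<zeta>. 0 < \<delta> \<Longrightarrow> \<delta> < d \<Longrightarrow> cmod \<zeta> = 1 \<Longrightarrow> carleson_quot \<omega> \<phi> \<delta> \<zeta> \<le> ennreal \<epsilon>"
proof (rule ccontr)
  assume neg: "\<not> thesis"
  note witness = that
  have ex: "\<exists>\<delta> \<zeta>. 0 < \<delta> \<and> \<delta> < d \<and> cmod \<zeta> = 1 \<and> \<not> carleson_quot \<omega> \<phi> \<delta> \<zeta> \<le> ennreal \<epsilon>" if "0 < d" for d
    using witness[of d] neg that by blast
  have "\<exists>\<delta> \<zeta>. 0 < \<delta> \<and> \<delta> < 1 / (real n + 1) \<and> cmod \<zeta> = 1 \<and> \<not> carleson_quot \<omega> \<phi> \<delta> \<zeta> \<le> ennreal \<epsilon>" for n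
    by (rule ex) simp
  then obtain \<delta> \<zeta> where *: "\<And>n. 0 < \<delta> n" "\<And>n. \<delta> n < 1 / (real n + 1)" "\<And>n. cmod (\<zeta> n) = 1"
    "\<And>n. \<not> carleson_quot \<omega> \<phi> (\<delta> n) (\<zeta> n) \<le> ennreal \<epsilon>"
    by metis
  have \<delta>1: "\<delta> n < 1" for n
  proof -
    have "1 / (real n + 1) \<le> 1" by simp
    then show ?thesis using *(2)[of n] by linarith
  qed
  have \<delta>0: "\<delta> \<longlonglongrightarrow> 0"
  proof (rule tendsto_sandwich[of "\<lambda>_. 0" _ _ "\<lambda>n. 1 / (real n + 1)"])
    show "(\<lambda>n. 1 / (real n + 1)) \<longlonglongrightarrow> 0"
      using LIMSEQ_inverse_real_of_nat by (simp add: inverse_eq_divide add.commute)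
  qed (use * in \<open>auto intro: less_imp_le always_eventually\<close>)
  define F where "F n = test_fun (\<delta> n) (\<zeta> n)" for n
  have F: "F n \<in> Hw \<omega>" "Hnorm \<omega> (F n) \<le> 1" "F n holomorphic_on ball 0 1" for n
    unfolding F_def using * \<delta>1 by (blast intro: test_fun_in_Hw Hnorm_test_fun_le_1 holomorphic_test_fun)+
  obtain r g where r: "strict_mono r" and g: "g \<in> Hw \<omega>"
    and lim: "(\<lambda>n. Hnorm \<omega> (\<lambda>z. (F (r n) \<circ> \<phi>) z - g z)) \<longlonglongrightarrow> 0"
    using comp F(1,2) unfolding comp_compact_def by blast
  have Fphi: "F n \<circ> \<phi> \<in> Hw \<omega>" for n using comp F(1) unfolding comp_compact_def by blast
  have holg: "g holomorphic_on ball 0 1" using g by (simp add: Hw_def)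
  define h where "h n = (\<lambda>z. (F (r n) \<circ> \<phi>) z - g z)" for n
  have holFphi: "F n \<circ> \<phi> holomorphic_on ball 0 1" for n using Fphi by (simp add: Hw_def)
  have holh: "h n holomorphic_on ball 0 1" for n
    unfolding h_def by (intro holomorphic_on_diff holFphi holg)
  have dh: "deriv (h n) z = deriv (F (r n) \<circ> \<phi>) z - deriv g z" if "z \<in> ball 0 1" for n z
    unfolding h_def by (rule deriv_diff_holomorphic[OF holFphi holg that])
  \<comment> \<open>\<open>Hnorm\<close> reads an infinite Dirichlet integral as 0, so the norm
    convergence is informative only once \<open>h n\<close> is known to lie in the space.\<close>
  have hHw: "h n \<in> Hw \<omega>" for n
  proof -
    have "Dint \<omega> (h n) \<le> 2 * Dint \<omega> (F (r n) \<circ> \<phi>) + 2 * Dint \<omega> g"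
      by (rule Dint_le_2_add[OF holFphi holg]) (simp add: dh norm_triangle_ineq4)
    also have "\<dots> < \<infinity>" using Fphi[of "r n"] g by (simp add: Hw_def ennreal_mult_less_top)
    finally show ?thesis using holh by (simp add: Hw_def)
  qed
  have Dh: "\<forall>\<^sub>F n in sequentially. Dint \<omega> (h n) \<le> ennreal e" if "0 < e" for e
  proof -
    have "(\<lambda>n. (Hnorm \<omega> (h n))\<^sup>2) \<longlonglongrightarrow> 0\<^sup>2"
      using lim unfolding h_def by (intro tendsto_power)
    then have "\<forall>\<^sub>F n in sequentially. (Hnorm \<omega> (h n))\<^sup>2 < e"
      using that by (intro order_tendstoD) auto
    then show ?thesis
    proof eventually_elim
      case (elim n)
      then show ?case
        using Dint_le_Hnorm_square[OF hHw] by (meson ennreal_leI less_imp_le order_trans)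
    qed
  qed
  have dlim: "(\<lambda>n. cmod (deriv (h n) z)) \<longlonglongrightarrow> cmod (deriv g z)" if z: "z \<in> ball 0 1" for z
  proof -
    have pz: "\<phi> z \<in> ball 0 1" using range z by blast
    define c where "c = 1 / (sqrt (\<omega> 0) * (1 - cmod (\<phi> z)) ^ (q + 2)) * cmod (deriv \<phi> z)"
    have "(\<lambda>n. deriv (F (r n) \<circ> \<phi>) z) \<longlonglongrightarrow> 0"
    proof (rule Lim_null_comparison)
      show "\<forall>\<^sub>F n in sequentially. cmod (deriv (F (r n) \<circ> \<phi>) z) \<le> \<delta> (r n) * c"
      proof (rule always_eventually, rule allI)
        fix n
        have "cmod (deriv (F (r n) \<circ> \<phi>) z) = cmod (deriv (F (r n)) (\<phi> z)) * cmod (deriv \<phi> z)"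
          by (simp only: deriv_comp[OF F(3) z] norm_mult)
        also have "\<dots> \<le> \<delta> (r n) / (sqrt (\<omega> 0) * (1 - cmod (\<phi> z)) ^ (q + 2)) * cmod (deriv \<phi> z)"
          unfolding F_def using * \<delta>1 pz by (intro mult_right_mono cmod_deriv_test_fun_le) auto
        finally show "cmod (deriv (F (r n) \<circ> \<phi>) z) \<le> \<delta> (r n) * c" by (simp only: c_def times_divide_eq_right times_divide_eq_left mult_1_right mult_1_left)
      qed
      have "(\<lambda>n. \<delta> (r n) * c) \<longlonglongrightarrow> 0 * c"
        using LIMSEQ_subseq_LIMSEQ[OF \<delta>0 r] by (intro tendsto_mult tendsto_const) (simp add: o_def)
      then show "(\<lambda>n. \<delta> (r n) * c) \<longlonglongrightarrow> 0" by simp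
    qed
    then have "(\<lambda>n. deriv (F (r n) \<circ> \<phi>) z - deriv g z) \<longlonglongrightarrow> 0 - deriv g z"
      by (intro tendsto_diff tendsto_const)
    then have "(\<lambda>n. cmod (deriv (F (r n) \<circ> \<phi>) z - deriv g z)) \<longlonglongrightarrow> cmod (0 - deriv g z)"
      by (rule tendsto_norm)
    then show ?thesis by (simp add: dh[OF z])
  qed
  have Dg: "Dint \<omega> g \<le> ennreal e" if "0 < e" for e
    by (rule Dint_Fatou[of h]) (use holh dlim Dh[OF that] in auto)
  \<comment> \<open>Recovering the composition from \<open>h n\<close> and \<open>g\<close> costs
    \<open>2 * e + 2 * e\<close>, and the test function bound costs \<open>4 ^ (q + 2)\<close>;
    together this makes exactly \<epsilon>.\<close>
  define e where "e = \<epsilon> / (4 * 4 ^ (q + 2))"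
  have e: "0 < e" using \<epsilon> by (simp add: e_def)
  obtain n where n: "Dint \<omega> (h n) \<le> ennreal e"
    using eventually_happens[OF Dh[OF e]] by auto
  have "Dint \<omega> (F (r n) \<circ> \<phi>) \<le> 2 * Dint \<omega> (h n) + 2 * Dint \<omega> g"
  proof (rule Dint_le_2_add[OF holh holg])
    fix z :: complex assume "z \<in> ball 0 1"
    then have "deriv (F (r n) \<circ> \<phi>) z = deriv (h n) z + deriv g z" by (simp add: dh)
    then show "cmod (deriv (F (r n) \<circ> \<phi>) z) \<le> cmod (deriv (h n) z) + cmod (deriv g z)"
      by (simp add: norm_triangle_ineq)
  qed
  also have "\<dots> \<le> ennreal 2 * ennreal e + ennreal 2 * ennreal e"
    using n Dg[OF e] by (intro add_mono mult_mono) auto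
  also have "\<dots> = ennreal (2 * e + 2 * e)"
    using e by (simp only: ennreal_mult[symmetric] ennreal_plus[symmetric] less_imp_le zero_le_numeral mult_nonneg_nonneg)
  also have "2 * e + 2 * e = 4 * e" by simp
  finally have "ennreal (4 ^ (q + 2)) * Dint \<omega> (F (r n) \<circ> \<phi>) \<le> ennreal (4 ^ (q + 2)) * ennreal (4 * e)"
    by (rule mult_left_mono) simp
  also have "\<dots> = ennreal (4 ^ (q + 2) * (4 * e))"
    using e by (intro ennreal_mult[symmetric]) auto
  also have "4 ^ (q + 2) * (4 * e) = \<epsilon>" by (simp add: e_def)
  finally have "carleson_quot \<omega> \<phi> (\<delta> (r n)) (\<zeta> (r n)) \<le> ennreal \<epsilon>"
    using carleson_quot_le_Dint_test_fun[OF *(1) \<delta>1 *(3), of "r n"] unfolding F_def by (rule order_trans[rotated])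
  then show False using *(4) by blast
qed

section \<open>The two criteria\<close>

theorem comp_bounded_iff:
  "comp_bounded \<omega> \<phi> \<longleftrightarrow> (SUP \<delta>\<in>{0<..<1}. SUP \<zeta>\<in>sphere 0 1. carleson_quot \<omega> \<phi> \<delta> \<zeta>) < \<infinity>"
  (is "_ \<longleftrightarrow> ?S < \<infinity>")
proof
  assume "comp_bounded \<omega> \<phi>"
  then obtain C where "\<And>\<delta> \<zeta>. 0 < \<delta> \<Longrightarrow> \<delta> < 1 \<Longrightarrow> cmod \<zeta> = 1 \<Longrightarrow> carleson_quot \<omega> \<phi> \<delta> \<zeta> \<le> ennreal C"
    using carleson_quot_bounded by blast
  then have "?S \<le> ennreal C" by (intro SUP_least) auto
  then show "?S < \<infinity>" by (auto intro: le_less_trans)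
next
  assume S: "?S < \<infinity>"
  show "comp_bounded \<omega> \<phi>"
  \<comment> \<open>With \<open>r = 1/2\<close> the admissible range of \<delta> is all of (0,1),
    matching the supremum.\<close>
  proof (rule comp_boundedI[of "1/2" "enn2real ?S"])
    fix \<delta> :: real and \<zeta> :: complex assume "0 < \<delta>" "\<delta> < 2 * (1 - 1/2)" "cmod \<zeta> = 1"
    then have "carleson_quot \<omega> \<phi> \<delta> \<zeta> \<le> ?S"
      by (intro SUP_upper2[of \<delta>] SUP_upper) auto
    then show "carleson_quot \<omega> \<phi> \<delta> \<zeta> \<le> ennreal (enn2real ?S)" using S by simp
  qed auto
qed

theorem comp_compact_iff:
  "comp_compact \<omega> \<phi> \<longleftrightarrow> ((\<lambda>\<delta>. SUP \<zeta>\<in>sphere 0 1. carleson_quot \<omega> \<phi> \<delta> \<zeta>) \<longlongrightarrow> 0) (at_right 0)"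
proof
  assume comp: "comp_compact \<omega> \<phi>"
  show "((\<lambda>\<delta>. SUP \<zeta>\<in>sphere 0 1. carleson_quot \<omega> \<phi> \<delta> \<zeta>) \<longlongrightarrow> 0) (at_right 0)"
  proof (rule order_tendstoI)
    fix a :: ennreal assume "0 < a"
    \<comment> \<open>An intermediate \<open>b\<close> is finite even if \<open>a\<close> is not,
      and leaves room for the strict inequality after taking the supremum over \<zeta>.\<close>
    then obtain b where b: "0 < b" "b < a" using dense by blast
    then have "b < top" using less_le_trans top_greatest by blast
    then obtain \<epsilon> where \<epsilon>: "b = ennreal \<epsilon>" "0 < \<epsilon>"
      using b(1) by (cases b) auto
    obtain d where d: "0 < d" "\<And>\<delta> \<zeta>. 0 < \<delta> \<Longrightarrow> \<delta> < d \<Longrightarrow> cmod \<zeta> = 1 \<Longrightarrow> carleson_quot \<omega> \<phi> \<delta> \<zeta> \<le> ennreal \<epsilon>"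
      using carleson_quot_vanishing[OF comp \<epsilon>(2)] by blast
    have "(SUP \<zeta>\<in>sphere 0 1. carleson_quot \<omega> \<phi> \<delta> \<zeta>) < a" if "0 < \<delta>" "\<delta> < d" for \<delta>
    proof -
      have "(SUP \<zeta>\<in>sphere 0 1. carleson_quot \<omega> \<phi> \<delta> \<zeta>) \<le> ennreal \<epsilon>"
        using d(2)[OF that] by (intro SUP_least) auto
      then show ?thesis using b \<epsilon> by (auto intro: le_less_trans)
    qed
    then show "\<forall>\<^sub>F \<delta> in at_right 0. (SUP \<zeta>\<in>sphere 0 1. carleson_quot \<omega> \<phi> \<delta> \<zeta>) < a"
      using d(1) by (auto simp: eventually_at_right_field)
  qed simp
next
  assume lim: "((\<lambda>\<delta>. SUP \<zeta>\<in>sphere 0 1. carleson_quot \<omega> \<phi> \<delta> \<zeta>) \<longlongrightarrow> 0) (at_right 0)"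
  show "comp_compact \<omega> \<phi>"
  proof (rule comp_compactI)
    fix \<epsilon> :: real assume "0 < \<epsilon>"
    then have "\<forall>\<^sub>F \<delta> in at_right 0. (SUP \<zeta>\<in>sphere 0 1. carleson_quot \<omega> \<phi> \<delta> \<zeta>) < ennreal \<epsilon>"
      using lim by (intro order_tendstoD) auto
    then obtain d where d: "0 < d" "\<And>\<delta>. 0 < \<delta> \<Longrightarrow> \<delta> < d \<Longrightarrow> (SUP \<zeta>\<in>sphere 0 1. carleson_quot \<omega> \<phi> \<delta> \<zeta>) < ennreal \<epsilon>"
      by (auto simp: eventually_at_right_field)
    have "carleson_quot \<omega> \<phi> \<delta> \<zeta> \<le> ennreal \<epsilon>" if "0 < \<delta>" "\<delta> < d" "cmod \<zeta> = 1" for \<delta> \<zeta>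
    proof -
      have "carleson_quot \<omega> \<phi> \<delta> \<zeta> \<le> (SUP \<zeta>\<in>sphere 0 1. carleson_quot \<omega> \<phi> \<delta> \<zeta>)"
        using that by (intro SUP_upper) auto
      then show ?thesis using d(2)[OF that(1,2)] by (meson less_imp_le order_trans)
    qed
    then show "\<exists>d>0. \<forall>\<delta> \<zeta>. 0 < \<delta> \<longrightarrow> \<delta> < d \<longrightarrow> cmod \<zeta> = 1 \<longrightarrow> carleson_quot \<omega> \<phi> \<delta> \<zeta> \<le> ennreal \<epsilon>"
      using d(1) by blast
  qed
qed

end

theorem theorem3p5:
  fixes \<omega> :: "real \<Rightarrow> real" and \<phi> :: "complex \<Rightarrow> complex"
  assumes "admissible_II \<omega>"
    and "\<phi> holomorphic_on ball 0 1" and "\<phi> ` ball 0 1 \<subseteq> ball 0 1"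
    and "\<phi> \<in> Hw \<omega>"
  shows "(comp_bounded \<omega> \<phi> \<longleftrightarrow>
           (SUP \<delta>\<in>{0<..<1}. SUP \<zeta>\<in>sphere 0 1. carleson_quot \<omega> \<phi> \<delta> \<zeta>) < \<infinity>) \<and>
         (comp_compact \<omega> \<phi> \<longleftrightarrow>
           ((\<lambda>\<delta>. SUP \<zeta>\<in>sphere 0 1. carleson_quot \<omega> \<phi> \<delta> \<zeta>) \<longlongrightarrow> 0) (at_right 0))"
proof -
  obtain q where "doubling_weight \<omega> q"
    using admissible_II_doubling_weight[OF assms(1)] .
  then interpret composition_symbol \<omega> q \<phi>
    using assms by (simp add: composition_symbol_def composition_symbol_axioms_def)
  show ?thesis using comp_bounded_iff comp_compact_iff by simp
qed

end
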